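(* Let $p=(p_0,p_1,\ldots)$ be an offspring distribution with mean $\mu\in(0,1]$ and $p_1\ne1$, let $\tau$ be a Galton-Watson tree with offspring distribution $p$, $\tau^{(k)}=(\tau_1,\ldots,\tau_k)$ a forest of $k$ i.i.d. copies of $\tau$, and $\tau^*$ the immortal tree associated with $p$. Let $A$ be a $\mathbb{Z}_+$-valued function on the space of finite forests, and write $v_n=\mathbf{P}[A(\tau)>n]$, $v_{(n)}=\mathbf{P}[A(\tau)=n]$, $v_{(n)}(k)=\mathbf{P}[A(\tau^{(k)})=n]$. Assume: (i) $v_n>0$ for all $n$; (ii) (additivity) there is a function $B:\mathbb{T}_0\to\mathbb{Z}_+$ such that for every fixed $b\in\mathbb{N}$ and $\mathbf{s}\in\mathbb{T}^{(b)}$, $$A(\mathbf{t})=A(\mathbf{t}_{(b)})+B(r_b(\mathbf{t}))\quad\text{for large enough }A(\mathbf{t})\text{ with }r_b(\mathbf{t})=\mathbf{s},$$ i.e. there is $n_0=n_0(b,\mathbf{s})$ such that the equality holds for all $\mathbf{t}\in\mathbb{T}_0$ with $r_b(\mathbf{t})=\mathbf{s}$ and $A(\mathbf{t})\ge n_0$; (iii) $\liminf_{n\to\infty}v_{(n)}(k)/v_{(n)}\ge k$ for every $k\in\mathbb{N}$; (iv) one of the following two conditions holds: I. $\mu=1$, and $\limsup_{n\to\infty}v_{(n)}/v_{(n-B(\mathbf{t}))}\le1$ for every $\mathbf{t}\in\mathbb{T}_0$; II. $0<\mu\le1$, $B(\mathbf{t})=H(\mathbf{t})$ for $\mathbf{t}\in\mathbb{T}_0$,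 and $\limsup_{n\to\infty}v_{(n+1)}/v_{(n)}\le\mu$. Then, as $n\to\infty$, $$\mathrm{dist}(\tau\mid A(\tau)=n)\to\mathrm{dist}(\tau^* ).$$ Here all limits are understood along the infinite sub-sequence $\{n:v_{(n)}>0\}$.
   Context: $\mathbb{Z}_+=\{0,1,2,\ldots\}$, $\mathbb{N}=\{1,2,\ldots\}$. Trees are rooted ordered trees in Neveu's formalism: a tree $\mathbf{t}$ is a set of finite sequences of positive integers containing the empty sequence $\emptyset$ (the root), closed under taking prefixes, such that for each $u\in\mathbf{t}$ there is $k_u(\mathbf{t})\in\mathbb{Z}_+$ (the out-degree) with $ui\in\mathbf{t}$ iff $1\le i\le k_u(\mathbf{t})$. $|u|$ is the length (height) of $u$. $\mathbb{T}$ is the set of trees, $\mathbb{T}_0$ the set of finite trees. $H(\mathbf{t})=\sup\{|u|:u\in\mathbf{t}\}$, $\mathbb{T}^{(h)}=\{\mathbf{t}:H(\mathbf{t})\le h\}$, $r_h(\mathbf{t})=\{u\in\mathbf{t}:|u|\le h\}$. A finite forest is a finite collection $(\mathbf{t}_1,\ldots,\mathbf{t}_k)$ of finite trees; a finite tree is regarded as a forest with one tree. $Y_b(\mathbf{t})$ is the number of nodes of $\mathbf{t}$ at height $b$; $\mathbf{t}_{(b)}=(\mathbf{t}_{(b),i},1\le i\le Y_b(\mathbf{t}))$ is the forest of subtrees above height $b$: if $u_1,u_2,\ldots$ are the nodes at height $b$ in order, $\mathbf{t}_{(b),i}=\{v:u_iv\in\mathbf{t}\}$. Convergence in distribution of $\mathbb{T}$-valued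 random variables is with respect to the distance $d(\mathbf{t},\mathbf{t}')=2^{-\sup\{h\in\mathbb{Z}_+:r_h(\mathbf{t})=r_h(\mathbf{t}')\}}$; equivalently, $T_n\to T$ in distribution iff $\mathbf{P}[r_h(T_n)=\mathbf{t}]\to\mathbf{P}[r_h(T)=\mathbf{t}]$ for all $h\in\mathbb{N}$ and $\mathbf{t}\in\mathbb{T}^{(h)}$. A Galton-Watson tree $\tau$ with offspring distribution $p$ is a random tree in which the out-degree of the root has law $p$ and, conditionally on it being $n$, the $n$ subtrees above height 1 are independent and distributed as $\tau$. For $0<\mu\le1$, $p_1\ne1$, $\tau\in\mathbb{T}_0$ a.s. The immortal tree $\tau^*$ of $p$: nodes are normal or special; the root is special; normal nodes have offspring distribution $p$, special nodes have the size-biased offspring distribution $\hat p_k=kp_k/\mu$; the offspring numbers of all nodes are independent; all children of a normal node are normal; among the children of a special node one chosen uniformly at random is special and the others are normal.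
   Formalization: In (ii), the equality is assumed for all finite t with r_b(t)=s and A(t)≥n_0 or A(t_(b))≥n_0, not only for A(t)≥n_0; with the one-sided condition alone the claim is false. *)

theory Defs
  imports "HOL-Probability.Probability" "HOL-Library.List_Lexorder"
begin

section \<open>Rooted ordered trees\<close>

text \<open>Neveu's formalism. The last condition forces all labels to be positive.\<close>

typedef tree = "{t :: nat list set. [] \<in> t \<and> (\<forall>u v. u @ v \<in> t \<longrightarrow> u \<in> t) \<and>
    (\<forall>u\<in>t. \<exists>k. \<forall>i. u @ [i] \<in> t \<longleftrightarrow> 1 \<le> i \<and> i \<le> k)}"
  morphisms nodes Tree
  by (rule exI[of _ "{[]}"]) (auto intro: exI[of _ 0])

definition outdeg :: "tree \<Rightarrow> nat list \<Rightarrow> nat" where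
  "outdeg t u = card {i. u @ [i] \<in> nodes t}"

definition finite_tree :: "tree \<Rightarrow> bool" where
  "finite_tree t \<longleftrightarrow> finite (nodes t)"

definition height :: "tree \<Rightarrow> enat" where
  "height t = (SUP u\<in>nodes t. enat (length u))"

definition trunc :: "nat \<Rightarrow> tree \<Rightarrow> tree" where
  "trunc h t = Tree {u \<in> nodes t. length u \<le> h}"

definition subtree :: "tree \<Rightarrow> nat list \<Rightarrow> tree" where
  "subtree t u = Tree {v. u @ v \<in> nodes t}"

text \<open>The list is sorted lexicographically, which is the left-to-right order on words of equal length.\<close>

definition level :: "nat \<Rightarrow> tree \<Rightarrow> nat list list" where
  "level b t = sorted_list_of_set {u \<in> nodes t. length u = b}"

definition forest_above :: "nat \<Rightarrow> tree \<Rightarrow> tree list" where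
  "forest_above b t = map (subtree t) (level b t)"

lemma nodes_trunc: "nodes (trunc h t) = {u \<in> nodes t. length u \<le> h}"
proof -
  have "[] \<in> nodes t" and pre: "\<And>u v. u @ v \<in> nodes t \<Longrightarrow> u \<in> nodes t"
    and deg: "\<And>u. u \<in> nodes t \<Longrightarrow> \<exists>k. \<forall>i. u @ [i] \<in> nodes t \<longleftrightarrow> 1 \<le> i \<and> i \<le> k"
    using nodes[of t] by blast+
  moreover have "\<exists>k. \<forall>i. u @ [i] \<in> nodes t \<and> length (u @ [i]) \<le> h \<longleftrightarrow> 1 \<le> i \<and> i \<le> k"
    if "u \<in> nodes t" for u
  proof (cases "length u < h")
    case True
    then show ?thesis using deg[OF that] by (simp add: Suc_le_eq)
  next
    case False
    then show ?thesis by (intro exI[of _ 0]) auto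
  qed
  ultimately show ?thesis
    unfolding trunc_def by (subst Tree_inverse) auto
qed

lemma nodes_subtree:
  assumes "u \<in> nodes t"
  shows "nodes (subtree t u) = {v. u @ v \<in> nodes t}"
proof -
  have "\<And>u v. u @ v \<in> nodes t \<Longrightarrow> u \<in> nodes t"
    and "\<And>u. u \<in> nodes t \<Longrightarrow> \<exists>k. \<forall>i. u @ [i] \<in> nodes t \<longleftrightarrow> 1 \<le> i \<and> i \<le> k"
    using nodes[of t] by blast+
  with assms show ?thesis
    unfolding subtree_def
    by (subst Tree_inverse) (simp_all, metis append.assoc)
qed

section \<open>The local metric on trees\<close>

lemma trunc_eq_iff:
  "trunc h s = trunc h t \<longleftrightarrow> (\<forall>u. length u \<le> h \<longrightarrow> (u \<in> nodes s \<longleftrightarrow> u \<in> nodes t))"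
  by (simp only: nodes_inject[symmetric] nodes_trunc set_eq_iff mem_Collect_eq) blast

lemma trunc_eq_mono: "trunc h s = trunc h t \<Longrightarrow> k \<le> h \<Longrightarrow> trunc k s = trunc k t"
  unfolding trunc_eq_iff by simp

lemma trunc_differ:
  assumes "s \<noteq> t"
  obtains m where "{h. trunc h s = trunc h t} \<subseteq> {..m}"
proof -
  have "nodes s \<noteq> nodes t"
    using assms by (simp add: nodes_inject)
  then obtain u where u: "(u \<in> nodes s) \<noteq> (u \<in> nodes t)"
    by blast
  have "h \<le> length u" if "trunc h s = trunc h t" for h
    using that u unfolding trunc_eq_iff by (metis nat_le_linear)
  then have "{h. trunc h s = trunc h t} \<subseteq> {..length u}"
    by blast
  then show thesis by (rule that)
qed

instantiation tree :: metric_space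
begin

text \<open>For equal trees the supremum below is infinite, hence the case distinction.\<close>

definition dist_tree :: "tree \<Rightarrow> tree \<Rightarrow> real" where
  "dist_tree s t = (if s = t then 0 else (1 / 2) ^ Sup {h. trunc h s = trunc h t})"

definition uniformity_tree :: "(tree \<times> tree) filter" where
  "uniformity_tree = (INF e\<in>{0 <..}. principal {(x, y). dist x y < e})"

definition open_tree :: "tree set \<Rightarrow> bool" where
  "open_tree U \<longleftrightarrow> (\<forall>x\<in>U. eventually (\<lambda>(x', y). x' = x \<longrightarrow> y \<in> U) uniformity)"

instance
proof
  show "uniformity = (INF e\<in>{0 <..}. principal {(x :: tree, y). dist x y < e})"
    by (rule uniformity_tree_def)
  show "open U \<longleftrightarrow> (\<forall>x\<in>U. eventually (\<lambda>(x', y). x' = x \<longrightarrow> y \<in> U) uniformity)"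
    for U :: "tree set"
    by (rule open_tree_def)
  show "dist x y = 0 \<longleftrightarrow> x = y" for x y :: tree
    by (simp add: dist_tree_def)
  show "dist x y \<le> dist x z + dist y z" for x y z :: tree
  proof (cases "x = y \<or> x = z \<or> y = z")
    case True
    have sym: "dist y x = dist x y"
      unfolding dist_tree_def by (simp only: eq_commute[of y x] eq_commute[of "trunc _ y"])
    have nonneg: "0 \<le> dist a b" and refl: "dist a a = 0" for a b :: tree
      by (simp_all add: dist_tree_def)
    from True consider "x = y" | "x = z" | "y = z" by blast
    then show ?thesis
      using sym nonneg[of x z] refl[of x] refl[of z] by cases simp_all
  next
    case False
    define S where "S a b = {h. trunc h a = trunc h b}" for a b :: tree
    have S0: "0 \<in> S a b" for a b
      using nodes[of a] nodes[of b] by (simp add: S_def trunc_eq_iff)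
    have fin: "finite (S a b)" if "a \<noteq> b" for a b
      using trunc_differ[OF that] finite_subset[OF _ finite_atMost] unfolding S_def by blast
    have bdd: "bdd_above (S a b)" if "a \<noteq> b" for a b
      using fin[OF that] by simp
    have mem: "Sup (S a b) \<in> S a b" if "a \<noteq> b" for a b
    proof -
      have "Max (S a b) \<in> S a b"
        using fin[OF that] S0[of a b] by (intro Max_in) auto
      moreover have "Sup (S a b) = Max (S a b)"
        using fin[OF that] S0[of a b] by (intro cSup_eq_Max) auto
      ultimately show ?thesis by simp
    qed
    define m where "m = min (Sup (S x z)) (Sup (S y z))"
    have "trunc (Sup (S x z)) x = trunc (Sup (S x z)) z"
      using mem[of x z] False by (simp add: S_def)
    then have "m \<in> S x z"
      unfolding S_def m_def mem_Collect_eq by (rule trunc_eq_mono) simp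
    moreover have "trunc (Sup (S y z)) y = trunc (Sup (S y z)) z"
      using mem[of y z] False by (simp add: S_def)
    then have "m \<in> S y z"
      unfolding S_def m_def mem_Collect_eq by (rule trunc_eq_mono) simp
    ultimately have "m \<in> S x y" by (simp add: S_def)
    then have "m \<le> Sup (S x y)" using bdd False by (simp add: cSup_upper)
    then have "dist x y \<le> (1 / 2) ^ m"
      using False by (simp add: dist_tree_def S_def[symmetric] power_decreasing)
    also have "\<dots> \<le> dist x z + dist y z"
      using False by (auto simp: dist_tree_def S_def[symmetric] m_def min_def)
    finally show ?thesis .
  qed
qed

end

text \<open>Convergence in distribution of laws, as weak convergence along a filter of indices.\<close>

definition converges_in_law :: "(nat \<Rightarrow> tree measure) \<Rightarrow> tree measure \<Rightarrow> nat filter \<Rightarrow> bool" where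
  "converges_in_law L L' F \<longleftrightarrow>
    (\<forall>f :: tree \<Rightarrow> real. continuous_on UNIV f \<longrightarrow> bounded (range f) \<longrightarrow>
      ((\<lambda>n. \<integral>t. f t \<partial>L n) \<longlongrightarrow> (\<integral>t. f t \<partial>L')) F)"

section \<open>Galton--Watson trees and the immortal tree\<close>

definition offspring_mean :: "nat pmf \<Rightarrow> real" where
  "offspring_mean p = measure_pmf.expectation p real"

text \<open>The branching property in product form: the root has \<open>n\<close> children with probability
  \<open>p\<^sub>n\<close>, and given this the \<open>n\<close> subtrees above height 1 are independent copies of the tree.\<close>

definition galton_watson :: "nat pmf \<Rightarrow> 'a measure \<Rightarrow> ('a \<Rightarrow> tree) \<Rightarrow> bool" where
  "galton_watson p M \<tau> \<longleftrightarrow> \<tau> \<in> borel_measurable M \<and>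
    (\<forall>n. \<forall>C :: nat \<Rightarrow> tree set. (\<forall>i. C i \<in> sets borel) \<longrightarrow>
      \<P>(\<omega> in M. outdeg (\<tau> \<omega>) [] = n \<and> (\<forall>i\<in>{1..n}. subtree (\<tau> \<omega>) [i] \<in> C i)) =
      pmf p n * (\<Prod>i\<in>{1..n}. \<P>(\<omega> in M. \<tau> \<omega> \<in> C i)))"

text \<open>Meaningful when the mean is finite and positive.\<close>

definition size_biased :: "nat pmf \<Rightarrow> nat pmf" where
  "size_biased p = embed_pmf (\<lambda>k. real k * pmf p k / offspring_mean p)"

text \<open>The offspring number of a special node, together with the label of its special child.\<close>

definition special_pmf :: "nat pmf \<Rightarrow> (nat \<times> nat) pmf" where
  "special_pmf p = bind_pmf (size_biased p) (\<lambda>k. map_pmf (Pair k) (pmf_of_set {1..k}))"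

text \<open>Every word \<open>u\<close> independently receives a value \<open>\<omega> u = (a, (k, j))\<close>: if \<open>u\<close> is a normal node
  it has \<open>a\<close> children, and if it is special it has \<open>k\<close> children, of which the \<open>j\<close>-th is special.\<close>

type_synonym marks = "nat list \<Rightarrow> nat \<times> (nat \<times> nat)"

definition marks_law :: "nat pmf \<Rightarrow> marks measure" where
  "marks_law p = (\<Pi>\<^sub>M u\<in>UNIV. measure_pmf (pair_pmf p (special_pmf p)))"

definition is_special :: "marks \<Rightarrow> nat list \<Rightarrow> bool" where
  "is_special \<omega> u \<longleftrightarrow> (\<forall>i<length u. u ! i = snd (snd (\<omega> (take i u))))"

definition offspring :: "marks \<Rightarrow> nat list \<Rightarrow> nat" where
  "offspring \<omega> u = (if is_special \<omega> u then fst (snd (\<omega> u)) else fst (\<omega> u))"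

definition immortal_tree :: "marks \<Rightarrow> tree" where
  "immortal_tree \<omega> = Tree {u. \<forall>i<length u. 1 \<le> u ! i \<and> u ! i \<le> offspring \<omega> (take i u)}"

definition immortal_law :: "nat pmf \<Rightarrow> tree measure" where
  "immortal_law p = distr (marks_law p) borel immortal_tree"

lemma nodes_immortal_tree:
  "nodes (immortal_tree \<omega>) = {u. \<forall>i<length u. 1 \<le> u ! i \<and> u ! i \<le> offspring \<omega> (take i u)}"
proof -
  let ?S = "{u. \<forall>i<length u. 1 \<le> u ! i \<and> u ! i \<le> offspring \<omega> (take i u)}"
  have "u \<in> ?S" if "u @ v \<in> ?S" for u v
  proof -
    have "1 \<le> u ! i \<and> u ! i \<le> offspring \<omega> (take i u)" if "i < length u" for i
      using \<open>u @ v \<in> ?S\<close> that by (force simp: nth_append dest: spec[of _ i])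
    then show ?thesis by simp
  qed
  moreover have "\<exists>k. \<forall>i. u @ [i] \<in> ?S \<longleftrightarrow> 1 \<le> i \<and> i \<le> k" if "u \<in> ?S" for u
    using that by (intro exI[of _ "offspring \<omega> u"]) (auto simp: nth_append less_Suc_eq)
  moreover have "[] \<in> ?S" by simp
  ultimately have "?S \<in> {t. [] \<in> t \<and> (\<forall>u v. u @ v \<in> t \<longrightarrow> u \<in> t) \<and>
      (\<forall>u\<in>t. \<exists>k. \<forall>i. u @ [i] \<in> t \<longleftrightarrow> 1 \<le> i \<and> i \<le> k)}"
    by blast
  then show ?thesis
    unfolding immortal_tree_def by (rule Tree_inverse)
qed

section \<open>Functionals of forests\<close>

text \<open>Forests consist of finite trees, so a functional \<open>A\<close> is only meaningful on lists of finite
  trees. Its values on other lists are arbitrary, and the events below exclude such lists.\<close>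

definition forest_event ::
  "(tree list \<Rightarrow> nat) \<Rightarrow> 'a measure \<Rightarrow> ('a \<Rightarrow> tree list) \<Rightarrow> (nat \<Rightarrow> bool) \<Rightarrow> 'a set" where
  "forest_event A M F P = {\<omega> \<in> space M. (\<forall>t\<in>set (F \<omega>). finite_tree t) \<and> P (A (F \<omega>))}"

definition tail_prob :: "(tree list \<Rightarrow> nat) \<Rightarrow> 'a measure \<Rightarrow> ('a \<Rightarrow> tree) \<Rightarrow> nat \<Rightarrow> real" where
  "tail_prob A M \<tau> n = measure M (forest_event A M (\<lambda>\<omega>. [\<tau> \<omega>]) (\<lambda>a. a > n))"

definition point_prob :: "(tree list \<Rightarrow> nat) \<Rightarrow> 'a measure \<Rightarrow> ('a \<Rightarrow> tree) \<Rightarrow> nat \<Rightarrow> real" where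
  "point_prob A M \<tau> n = measure M (forest_event A M (\<lambda>\<omega>. [\<tau> \<omega>]) (\<lambda>a. a = n))"

definition forest_point_prob ::
  "(tree list \<Rightarrow> nat) \<Rightarrow> 'a measure \<Rightarrow> (nat \<Rightarrow> 'a \<Rightarrow> tree) \<Rightarrow> nat \<Rightarrow> nat \<Rightarrow> real" where
  "forest_point_prob A M T k n =
    measure M (forest_event A M (\<lambda>\<omega>. map (\<lambda>i. T i \<omega>) [1..<Suc k]) (\<lambda>a. a = n))"

definition conditional_law ::
  "(tree list \<Rightarrow> nat) \<Rightarrow> 'a measure \<Rightarrow> ('a \<Rightarrow> tree) \<Rightarrow> nat \<Rightarrow> tree measure" where
  "conditional_law A M \<tau> n =
    distr (uniform_measure M (forest_event A M (\<lambda>\<omega>. [\<tau> \<omega>]) (\<lambda>a. a = n))) borel \<tau>"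

text \<open>The filter of limits along the subsequence \<open>{n. v n > 0}\<close>.\<close>

definition along_positive :: "(nat \<Rightarrow> real) \<Rightarrow> nat filter" where
  "along_positive v = inf sequentially (principal {n. v n > 0})"

text \<open>``For large enough \<open>A\<close>'' is read on both sides of the equation: either \<open>A [t]\<close> or
  \<open>A (forest_above b t)\<close> is large. Requiring the equation only for large \<open>A [t]\<close> would not bound
  below the probability that \<open>A [t] = n\<close> by that of \<open>A (forest_above b t) = n - B (trunc b t)\<close>.\<close>

definition additive_for_large :: "(tree list \<Rightarrow> nat) \<Rightarrow> (tree \<Rightarrow> nat) \<Rightarrow> bool" where
  "additive_for_large A B \<longleftrightarrow> (\<forall>b\<ge>1. \<forall>s. height s \<le> enat b \<longrightarrow>
    (\<exists>n\<^sub>0. \<forall>t. finite_tree t \<longrightarrow> trunc b t = s \<longrightarrow> (n\<^sub>0 \<le> A [t] \<or> n\<^sub>0 \<le> A (forest_above b t)) \<longrightarrow>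
      A [t] = A (forest_above b t) + B (trunc b t)))"

end

theory Submission
  imports Defs
begin

text \<open>
  Write \<open>v\<^sub>n\<close> and \<open>v\<^sub>n(k)\<close> for the probabilities that \<open>A\<close> takes the value \<open>n\<close> at \<open>\<tau>\<close> and at a forest
  of \<open>k\<close> copies of \<open>\<tau>\<close>. Fix a height \<open>b \<ge> 1\<close> and a tree \<open>s\<close> of height at most \<open>b\<close>, with \<open>k\<close> nodes at
  height \<open>b\<close>, and let \<open>w\<close> be the probability that \<open>\<tau>\<close> truncated at height \<open>b\<close> is \<open>s\<close>.

  Three facts are combined. By the branching property the forest above height \<open>b\<close> is, given this
  truncation, a forest of \<open>k\<close> independent copies (\<open>galton_watson_forest_above\<close>), so that additivity
  gives, for \<open>k \<ge> 1\<close> and large \<open>n\<close>, a lower bound \<open>w v\<^sub>n\<^sub>-\<^sub>B\<^sub>s(k)\<close> for the probability that \<open>\<tau>\<close> has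
  truncation \<open>s\<close> and \<open>A\<close> has the value \<open>n\<close> (\<open>joint_prob_ge\<close>). Dividing by \<open>v\<^sub>n\<close>, the hypotheses on
  the ratios show that along the support of \<open>v\<close> the conditional probability of truncation \<open>s\<close> has
  lower limit at least \<open>w k / \<mu>\<^sup>b\<close> (\<open>eventually_conditional_cylinder\<close>). In the critical case
  the exponent \<open>b\<close> plays no role; in the other case \<open>B s = b\<close>, and each of the \<open>b\<close> steps from
  \<open>n - b\<close> to \<open>n\<close> contributes a factor \<open>1 / \<mu>\<close>. Finally, the immortal tree has truncation \<open>s\<close>
  with probability at most \<open>w k / \<mu>\<^sup>b\<close> (\<open>immortal_law_cylinder_le\<close>): sum over the \<open>k\<close>
  possible positions of the special node at height \<open>b\<close>.

  Thus the conditional laws asymptotically charge every cylinder at least as much as the law of the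
  immortal tree does. The latter is a probability measure, so no mass is left over, and these lower
  bounds alone imply weak convergence (\<open>converges_in_law_if_cylinders\<close>).
\<close>

section \<open>Trees as sets of words\<close>

lemma root_in_nodes [simp]: "[] \<in> nodes t"
  using nodes[of t] by blast

lemma nodes_prefix: "u @ v \<in> nodes t \<Longrightarrow> u \<in> nodes t"
  using nodes[of t] by blast

lemma nodes_children: "u \<in> nodes t \<Longrightarrow> \<exists>k. \<forall>i. u @ [i] \<in> nodes t \<longleftrightarrow> 1 \<le> i \<and> i \<le> k"
  using nodes[of t] by blast

lemma child_in_nodes_iff:
  assumes "u \<in> nodes t"
  shows "u @ [i] \<in> nodes t \<longleftrightarrow> 1 \<le> i \<and> i \<le> outdeg t u"
proof -
  obtain k where k: "\<forall>i. u @ [i] \<in> nodes t \<longleftrightarrow> 1 \<le> i \<and> i \<le> k"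
    using nodes_children[OF assms] by (rule exE)
  have "{i. u @ [i] \<in> nodes t} = {1..k}" by (auto simp add: k)
  then have "outdeg t u = k" by (simp add: outdeg_def)
  with k show ?thesis by simp
qed

lemma Cons_in_nodes_iff:
  "i # w \<in> nodes t \<longleftrightarrow> 1 \<le> i \<and> i \<le> outdeg t [] \<and> w \<in> nodes (subtree t [i])"
proof (cases "[i] \<in> nodes t")
  case True
  then show ?thesis
    using child_in_nodes_iff[of "[]" t i] by (simp add: nodes_subtree)
next
  case False
  then show ?thesis
    using child_in_nodes_iff[of "[]" t i] nodes_prefix[of "[i]" w t] by auto
qed

lemma tree_eqI: "(\<And>u. u \<in> nodes s \<longleftrightarrow> u \<in> nodes t) \<Longrightarrow> s = t"
  by (metis nodes_inject set_eqI)

lemma finite_words_of_length: "finite {u \<in> nodes t. length u = b}"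
proof (induction b)
  case 0
  have "{u \<in> nodes t. length u = 0} = {[]}" by auto
  then show ?case by simp
next
  case (Suc b)
  have "{u \<in> nodes t. length u = Suc b} \<subseteq>
      (\<Union>u\<in>{u \<in> nodes t. length u = b}. (\<lambda>i. u @ [i]) ` {..outdeg t u})"
  proof
    fix w assume "w \<in> {u \<in> nodes t. length u = Suc b}"
    then have w: "w \<in> nodes t" "length w = Suc b" by auto
    then obtain u i where "w = u @ [i]" by (metis length_Suc_conv_rev)
    with w show "w \<in> (\<Union>u\<in>{u \<in> nodes t. length u = b}. (\<lambda>i. u @ [i]) ` {..outdeg t u})"
      using nodes_prefix[of u "[i]" t] child_in_nodes_iff[of u t i] by auto
  qed
  moreover have "finite (\<Union>u\<in>{u \<in> nodes t. length u = b}. (\<lambda>i. u @ [i]) ` {..outdeg t u})"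
    by (rule finite_UN_I[OF Suc]) simp
  ultimately show ?case by (rule finite_subset)
qed

lemma finite_words_upto: "finite {u \<in> nodes t. length u \<le> b}"
proof -
  have "{u \<in> nodes t. length u \<le> b} = (\<Union>m\<in>{..b}. {u \<in> nodes t. length u = m})" by auto
  then show ?thesis by (simp add: finite_words_of_length)
qed

lemma finite_words_below: "finite {u \<in> nodes t. length u < b}"
  by (rule finite_subset[OF _ finite_words_upto[of t b]]) auto

lemma height_le_iff: "height t \<le> enat b \<longleftrightarrow> (\<forall>u\<in>nodes t. length u \<le> b)"
  by (simp add: height_def SUP_le_iff)

lemma finite_tree_trunc: "finite_tree (trunc h t)"
  by (simp add: finite_tree_def nodes_trunc finite_words_upto)

lemma finite_tree_if_height_le: "height t \<le> enat b \<Longrightarrow> finite_tree t"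
  unfolding height_le_iff finite_tree_def
  by (rule finite_subset[OF _ finite_words_upto[of t b]]) auto

lemma height_trunc: "height (trunc h t) \<le> enat h"
  by (simp add: height_le_iff nodes_trunc)

lemma trunc_ident: "height t \<le> enat b \<Longrightarrow> trunc b t = t"
  unfolding height_le_iff by (rule tree_eqI) (auto simp: nodes_trunc)

lemma countable_finite_trees: "countable {t. finite_tree t}"
proof -
  have "inj_on nodes {t. finite_tree t}" by (simp add: inj_on_def nodes_inject)
  moreover have "countable (nodes ` {t. finite_tree t})"
    by (rule countable_subset[OF _ countable_Collect_finite]) (auto simp: finite_tree_def)
  ultimately show ?thesis using countable_image_inj_on by blast
qed

lemma finite_tree_height:
  assumes "finite_tree t"
  obtains b where "height t \<le> enat b"
proof -
  have "\<forall>u\<in>nodes t. length u \<le> Max (length ` nodes t)"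
    using assms by (simp add: finite_tree_def)
  then show thesis using that by (auto simp: height_le_iff)
qed

text \<open>A truncation strictly above the height of a finite tree identifies the tree.\<close>

lemma trunc_Suc_eq_iff:
  assumes "height s \<le> enat b"
  shows "trunc (Suc b) t = s \<longleftrightarrow> t = s"
proof
  assume eq: "trunc (Suc b) t = s"
  have short: "length u \<le> b" if "u \<in> nodes t" for u
  proof (rule ccontr)
    assume "\<not> length u \<le> b"
    then have "take (Suc b) u \<in> nodes (trunc (Suc b) t)"
      using nodes_prefix[of "take (Suc b) u" "drop (Suc b) u" t] that by (simp add: nodes_trunc)
    then have "length (take (Suc b) u) \<le> b" using eq assms by (auto simp: height_le_iff)
    with \<open>\<not> length u \<le> b\<close> show False by simp
  qed
  have "trunc (Suc b) t = t"
    by (rule tree_eqI) (use short in \<open>force simp: nodes_trunc\<close>)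
  with eq show "t = s" by simp
next
  assume "t = s"
  moreover have "height s \<le> enat (Suc b)" using assms by (auto simp: height_le_iff le_SucI)
  ultimately show "trunc (Suc b) t = s" by (simp add: trunc_ident)
qed

lemma trunc_Suc_eq_iff_subtrees:
  assumes "height s \<le> enat (Suc b)"
  shows "trunc (Suc b) t = s \<longleftrightarrow> outdeg t [] = outdeg s [] \<and>
    (\<forall>i\<in>{1..outdeg s []}. trunc b (subtree t [i]) = subtree s [i])"
proof
  assume eq: "trunc (Suc b) t = s"
  have in_s: "u \<in> nodes s \<longleftrightarrow> u \<in> nodes t \<and> length u \<le> Suc b" for u
    by (simp add: eq[symmetric] nodes_trunc)
  then have deg: "outdeg t [] = outdeg s []" by (simp add: outdeg_def)
  have "trunc b (subtree t [i]) = subtree s [i]" if i: "i \<in> {1..outdeg s []}" for i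
  proof (rule tree_eqI)
    fix w
    show "w \<in> nodes (trunc b (subtree t [i])) \<longleftrightarrow> w \<in> nodes (subtree s [i])"
      using in_s[of "i # w"] i deg by (simp add: nodes_trunc Cons_in_nodes_iff)
  qed
  with deg show "outdeg t [] = outdeg s [] \<and>
    (\<forall>i\<in>{1..outdeg s []}. trunc b (subtree t [i]) = subtree s [i])" by blast
next
  assume eq: "outdeg t [] = outdeg s [] \<and>
    (\<forall>i\<in>{1..outdeg s []}. trunc b (subtree t [i]) = subtree s [i])"
  show "trunc (Suc b) t = s"
  proof (rule tree_eqI)
    fix u
    show "u \<in> nodes (trunc (Suc b) t) \<longleftrightarrow> u \<in> nodes s"
    proof (cases u)
      case Nil
      then show ?thesis by (simp add: nodes_trunc)
    next
      case (Cons i w)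
      have "w \<in> nodes (subtree s [i]) \<longleftrightarrow> w \<in> nodes (subtree t [i]) \<and> length w \<le> b"
        if "1 \<le> i" "i \<le> outdeg s []"
      proof -
        have "nodes (subtree s [i]) = nodes (trunc b (subtree t [i]))" using eq that by simp
        then show ?thesis by (simp add: nodes_trunc)
      qed
      moreover have "outdeg t [] = outdeg s []" using eq by simp
      ultimately show ?thesis
        by (simp add: Cons nodes_trunc Cons_in_nodes_iff) blast
    qed
  qed
qed

lemma subtree_root [simp]: "subtree t [] = t"
  by (simp add: subtree_def nodes_inverse)

lemma subtree_subtree:
  assumes "u \<in> nodes t"
  shows "subtree (subtree t u) v = subtree t (u @ v)"
  unfolding subtree_def[of _ v] subtree_def[of _ "u @ v"] using assms by (simp add: nodes_subtree)

lemma outdeg_subtree: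
  assumes "u \<in> nodes t"
  shows "outdeg (subtree t u) v = outdeg t (u @ v)"
  using assms by (simp add: outdeg_def nodes_subtree)

lemma height_subtree:
  assumes "height s \<le> enat (Suc b)" "[i] \<in> nodes s"
  shows "height (subtree s [i]) \<le> enat b"
  using assms by (auto simp: height_le_iff nodes_subtree)

lemma set_level [simp]: "set (level b t) = {u \<in> nodes t. length u = b}"
  and distinct_level [simp]: "distinct (level b t)"
  by (simp_all add: level_def finite_words_of_length)

lemma length_level: "length (level b t) = card {u \<in> nodes t. length u = b}"
  by (simp add: level_def)

lemma level_trunc: "level b (trunc b t) = level b t"
  unfolding level_def by (rule arg_cong[where f = sorted_list_of_set]) (auto simp: nodes_trunc)

lemma finite_tree_forest_above:
  assumes "\<forall>t'\<in>set (forest_above b t). finite_tree t'"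
  shows "finite_tree t"
proof -
  have "nodes t \<subseteq> {u \<in> nodes t. length u \<le> b} \<union>
      (\<Union>u\<in>{u \<in> nodes t. length u = b}. (@) u ` nodes (subtree t u))"
  proof
    fix w assume w: "w \<in> nodes t"
    show "w \<in> {u \<in> nodes t. length u \<le> b} \<union>
      (\<Union>u\<in>{u \<in> nodes t. length u = b}. (@) u ` nodes (subtree t u))"
    proof (cases "length w \<le> b")
      case False
      have "take b w \<in> nodes t" using w nodes_prefix[of "take b w" "drop b w"] by simp
      moreover from this have "drop b w \<in> nodes (subtree t (take b w))"
        using w by (simp add: nodes_subtree)
      ultimately show ?thesis using False
        by (intro UnI2 UN_I[of "take b w"] image_eqI[of _ _ "drop b w"]) auto
    qed (use w in simp)
  qed
  moreover have "finite (nodes (subtree t u))" if "u \<in> nodes t" "length u = b" for u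
    using assms that by (auto simp: forest_above_def finite_tree_def)
  ultimately show ?thesis
    unfolding finite_tree_def
    by (intro finite_subset[of "nodes t"]) (auto simp: finite_words_upto finite_words_of_length)
qed

text \<open>Splitting a product over nodes at the root, along the subtrees above height 1.\<close>

lemma prod_nodes_split:
  fixes f :: "nat list \<Rightarrow> 'b :: comm_monoid_mult"
  assumes "finite {w \<in> nodes s. Q w}"
  shows "(\<Prod>w\<in>{w \<in> nodes s. w \<noteq> [] \<and> Q w}. f w) =
    (\<Prod>i\<in>{1..outdeg s []}. \<Prod>w\<in>{w \<in> nodes (subtree s [i]). Q (i # w)}. f (i # w))"
proof -
  let ?W = "\<lambda>i. {w \<in> nodes (subtree s [i]). Q (i # w)}"
  have fin: "finite ((#) i ` ?W i)" if "i \<in> {1..outdeg s []}" for i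
    by (rule finite_subset[OF _ assms]) (use that in \<open>auto simp: Cons_in_nodes_iff\<close>)
  have "{w \<in> nodes s. w \<noteq> [] \<and> Q w} = (\<Union>i\<in>{1..outdeg s []}. (#) i ` ?W i)" (is "?L = ?R")
  proof (rule set_eqI)
    fix u show "u \<in> ?L \<longleftrightarrow> u \<in> ?R"
      by (cases u) (auto simp: Cons_in_nodes_iff)
  qed
  then have "prod f ?L = prod f ?R" by simp
  also have "\<dots> = (\<Prod>i\<in>{1..outdeg s []}. prod f ((#) i ` ?W i))"
    by (rule prod.UNION_disjoint) (use fin in auto)
  also have "\<dots> = (\<Prod>i\<in>{1..outdeg s []}. \<Prod>w\<in>?W i. f (i # w))"
    by (rule prod.cong[OF refl], subst prod.reindex) (auto simp: inj_on_def)
  finally show ?thesis .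
qed

section \<open>The local topology\<close>

lemma dist_le_if_trunc_eq:
  fixes s t :: tree
  assumes "trunc h s = trunc h t"
  shows "dist s t \<le> (1 / 2) ^ h"
proof (cases "s = t")
  case False
  obtain m where "{h. trunc h s = trunc h t} \<subseteq> {..m}" by (rule trunc_differ[OF False])
  then have "bdd_above {h. trunc h s = trunc h t}" by (meson bdd_above_Iic bdd_above_mono)
  then have "h \<le> Sup {h. trunc h s = trunc h t}" using assms by (simp add: cSup_upper)
  then show ?thesis using False by (simp add: dist_tree_def power_decreasing)
qed simp

lemma trunc_eq_if_dist_less:
  fixes s t :: tree
  assumes "dist s t < (1 / 2) ^ h"
  shows "trunc h s = trunc h t"
proof (cases "s = t")
  case False
  let ?S = "{h. trunc h s = trunc h t}"
  obtain m where m: "?S \<subseteq> {..m}" by (rule trunc_differ[OF False])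
  have "(1 / 2 :: real) ^ Sup ?S < (1 / 2) ^ h" using assms False by (simp add: dist_tree_def)
  then have "h \<le> Sup ?S" by (auto intro: ccontr simp: power_strict_decreasing_iff)
  moreover have "Sup ?S \<in> ?S"
  proof -
    have ne: "?S \<noteq> {}" and fin: "finite ?S"
      using trunc_eq_iff[of 0 s t] finite_subset[OF m] by auto
    show ?thesis using Max_in[OF fin ne] unfolding cSup_eq_Max[OF fin ne] .
  qed
  ultimately show ?thesis using trunc_eq_mono by blast
qed simp

lemma open_trunc_vimage: "open {t. trunc h t \<in> S}"
  unfolding open_dist
proof
  fix t assume t: "t \<in> {t. trunc h t \<in> S}"
  have "t' \<in> {t. trunc h t \<in> S}" if "dist t' t < (1 / 2) ^ h" for t'
    using trunc_eq_if_dist_less[OF that] t by simp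
  moreover have "(1 / 2 :: real) ^ h > 0" by simp
  ultimately show "\<exists>e>0. \<forall>t'. dist t' t < e \<longrightarrow> t' \<in> {t. trunc h t \<in> S}" by blast
qed

lemma open_cylinder: "open {t. trunc h t = s}"
  using open_trunc_vimage[of h "{s}"] by simp

lemma sets_cylinder: "{t. trunc h t = s} \<in> sets borel"
  by (intro borel_open open_cylinder)

lemma open_tree_contains_cylinder:
  assumes "open U" "t \<in> U"
  obtains h where "{t'. trunc h t' = trunc h t} \<subseteq> U"
proof -
  obtain e where e: "e > 0" "\<And>t'. dist t' t < e \<Longrightarrow> t' \<in> U"
    using assms unfolding open_dist by blast
  obtain h where "(1 / 2 :: real) ^ h < e"
    using real_arch_pow_inv[of e "1/2"] e by auto
  then have "{t'. trunc h t' = trunc h t} \<subseteq> U"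
    using e dist_le_if_trunc_eq by force
  then show thesis by (rule that)
qed

text \<open>The cylinders form a countable base, so they suffice to test measurability.\<close>

lemma borel_measurable_treeI:
  fixes X :: "'a \<Rightarrow> tree"
  assumes "\<And>h s. {\<omega> \<in> space M. trunc h (X \<omega>) = s} \<in> sets M"
  shows "X \<in> borel_measurable M"
proof (rule borel_measurableI)
  fix U :: "tree set" assume U: "open U"
  let ?I = "{(h, s). finite_tree s \<and> {t. trunc h t = s} \<subseteq> U}"
  have "countable ?I"
    by (rule countable_subset[of _ "UNIV \<times> {s. finite_tree s}"])
      (auto intro: countable_finite_trees)
  moreover have "X -` U \<inter> space M = (\<Union>(h, s)\<in>?I. {\<omega> \<in> space M. trunc h (X \<omega>) = s})"
  proof (intro equalityI subsetI)
    fix \<omega> assume "\<omega> \<in> X -` U \<inter> space M"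
    moreover from this obtain h where "{t'. trunc h t' = trunc h (X \<omega>)} \<subseteq> U"
      using open_tree_contains_cylinder[OF U] by blast
    ultimately show "\<omega> \<in> (\<Union>(h, s)\<in>?I. {\<omega> \<in> space M. trunc h (X \<omega>) = s})"
      by (intro UN_I[of "(h, trunc h (X \<omega>))"]) (auto simp: finite_tree_trunc)
  qed auto
  ultimately show "X -` U \<inter> space M \<in> sets M"
    using assms by (auto intro!: sets.countable_UN'')
qed

text \<open>Off the nodes of a tree, \<^const>\<open>subtree\<close> is a constant default value, so that it is
  measurable without restriction.\<close>

lemma measurable_subtree: "(\<lambda>t. subtree t u) \<in> borel_measurable borel"
proof (rule borel_measurable_treeI)
  fix h s
  have "trunc h (subtree t u) = trunc h (subtree t' u)"
    if "trunc (length u + h) t = trunc (length u + h) t'" for t t'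
  proof -
    have eq: "\<And>v. length v \<le> length u + h \<Longrightarrow> v \<in> nodes t \<longleftrightarrow> v \<in> nodes t'"
      using that by (simp add: trunc_eq_iff)
    show ?thesis
    proof (cases "u \<in> nodes t")
      case True
      then have "u \<in> nodes t'" using eq[of u] by simp
      with True show ?thesis using eq by (simp add: trunc_eq_iff nodes_subtree)
    next
      case False
      then have "u \<notin> nodes t'" using eq[of u] by simp
      with False have "{v. u @ v \<in> nodes t} = {}" "{v. u @ v \<in> nodes t'} = {}"
        using nodes_prefix by blast+
      then show ?thesis by (simp add: subtree_def)
    qed
  qed
  note same = this
  let ?A = "{t. trunc h (subtree t u) = s}" and ?r = "trunc (length u + h)"
  have "?A = {t. ?r t \<in> ?r ` ?A}"
  proof (intro equalityI subsetI)
    fix t assume "t \<in> {t. ?r t \<in> ?r ` ?A}"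
    then obtain t' where "t' \<in> ?A" "?r t = ?r t'" by blast
    then show "t \<in> ?A" using same[of t t'] by simp
  qed blast
  then have "open ?A" using open_trunc_vimage[of "length u + h" "?r ` ?A"] by (rule ssubst)
  then show "{t \<in> space borel. trunc h (subtree t u) = s} \<in> sets borel"
    by (simp add: borel_open)
qed

section \<open>Weak convergence from cylinder probabilities\<close>

lemma borel_measurable_of_trunc:
  fixes f :: "tree \<Rightarrow> real"
  shows "(\<lambda>t. f (trunc h t)) \<in> borel_measurable borel"
proof (rule borel_measurableI)
  fix S :: "real set"
  have "open {t. trunc h t \<in> f -` S}" by (rule open_trunc_vimage)
  then show "(\<lambda>t. f (trunc h t)) -` S \<inter> space borel \<in> sets borel"
    by (simp add: vimage_def borel_open)
qed

lemma eventually_less_weighted_sum: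
  fixes a y :: "'b \<Rightarrow> real" and z :: "'c \<Rightarrow> 'b \<Rightarrow> real"
  assumes "finite E" and nonneg: "\<And>s. s \<in> E \<Longrightarrow> 0 \<le> a s"
    and lower: "\<And>s x. s \<in> E \<Longrightarrow> x < y s \<Longrightarrow> eventually (\<lambda>n. x < z n s) F"
    and c: "c < (\<Sum>s\<in>E. a s * y s)"
  shows "eventually (\<lambda>n. c < (\<Sum>s\<in>E. a s * z n s)) F"
proof -
  define d where "d = ((\<Sum>s\<in>E. a s * y s) - c) / (sum a E + 1)"
  have a: "0 \<le> sum a E" by (intro sum_nonneg nonneg)
  with c have d: "d > 0" by (simp add: d_def)
  have "d * (sum a E + 1) = (\<Sum>s\<in>E. a s * y s) - c"
    using a by (simp add: d_def)
  then have small: "d * sum a E < (\<Sum>s\<in>E. a s * y s) - c"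
    using d by (simp add: algebra_simps)
  have "eventually (\<lambda>n. \<forall>s\<in>E. y s - d < z n s) F"
    using d by (intro eventually_ball_finite \<open>finite E\<close> ballI lower) auto
  then show ?thesis
  proof (rule eventually_mono)
    fix n assume z: "\<forall>s\<in>E. y s - d < z n s"
    have "c < (\<Sum>s\<in>E. a s * y s) - d * sum a E" using small by simp
    also have "\<dots> = (\<Sum>s\<in>E. a s * (y s - d))"
      by (simp add: sum_subtractf sum_distrib_left algebra_simps)
    also have "\<dots> \<le> (\<Sum>s\<in>E. a s * z n s)"
      using z by (intro sum_mono mult_left_mono nonneg) auto
    finally show "c < (\<Sum>s\<in>E. a s * z n s)" .
  qed
qed

text \<open>A nonnegative continuous function is the limit, as \<open>h\<close> grows, of its infima over the cylinders
  of height \<open>h\<close>. Each of these infima takes only countably many values, so that it is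
  approximated from below by finite combinations of indicators of cylinders. This gives lower
  semicontinuity of the integral.\<close>

lemma eventually_less_integral:
  fixes L :: "'c \<Rightarrow> tree measure" and g :: "tree \<Rightarrow> real"
  assumes L: "eventually (\<lambda>n. prob_space (L n) \<and> sets (L n) = sets borel) F"
    and N: "prob_space N" "sets N = sets borel"
    and lower: "\<And>h s x. 1 \<le> h \<Longrightarrow> x < measure N {t. trunc h t = s} \<Longrightarrow>
      eventually (\<lambda>n. x < measure (L n) {t. trunc h t = s}) F"
    and cont: "continuous_on UNIV g" and g: "\<And>t. 0 \<le> g t" "\<And>t. g t \<le> K"
    and c: "c < (\<integral>t. g t \<partial>N)"
  shows "eventually (\<lambda>n. c < (\<integral>t. g t \<partial>L n)) F"
proof -
  define cyl where "cyl h s = {t. trunc h t = s}" for h s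
  \<comment> \<open>The case distinction keeps \<open>a\<close> nonnegative: \<open>Inf {}\<close> is an unspecified real.\<close>
  define a where "a h s = (if cyl h s = {} then 0 else Inf (g ` cyl h s))" for h s
  have meas_g: "g \<in> borel_measurable borel"
    using cont by (rule borel_measurable_continuous_onI)
  have bdd: "bdd_below (g ` S)" for S
    using g by (intro bdd_belowI[of _ 0]) auto
  have a_nonneg: "0 \<le> a h s" for h s
    using g by (auto simp: a_def intro!: cInf_greatest)
  have mem: "t \<in> cyl h (trunc h t)" for h t by (simp add: cyl_def)
  then have a_le: "a h (trunc h t) \<le> g t" for h t
    using bdd by (auto simp: a_def intro!: cInf_lower)
  have K: "0 \<le> K" using g order_trans by blast
  have a_le_K: "a h (trunc h t) \<le> K" for h t
    using a_le[of h t] g(2)[of t] by simp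
  have meas_a: "(\<lambda>t. a h (trunc h t)) \<in> borel_measurable borel" for h
    by (rule borel_measurable_of_trunc)
  have lim_a: "(\<lambda>h. a h (trunc h t)) \<longlonglongrightarrow> g t" for t
  proof (rule order_tendstoI)
    fix y assume "y < g t"
    then obtain z where z: "y < z" "z < g t" using dense by blast
    have "open {t'. z < g t'}"
      by (rule open_Collect_less[OF continuous_on_const cont])
    then obtain k where k: "{t'. trunc k t' = trunc k t} \<subseteq> {t'. z < g t'}"
      using open_tree_contains_cylinder[of "{t'. z < g t'}" t] z by auto
    have "y < a h (trunc h t)" if "k \<le> h" for h
    proof -
      have "z \<le> g t'" if "t' \<in> cyl h (trunc h t)" for t'
      proof -
        have "trunc k t' = trunc k t"
          using that \<open>k \<le> h\<close> trunc_eq_mono[of h t' t k] by (simp add: cyl_def)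
        then show ?thesis using k by auto
      qed
      then have "z \<le> Inf (g ` cyl h (trunc h t))"
        using mem[of t h] by (intro cInf_greatest) auto
      then show ?thesis using z mem[of t h] by (auto simp: a_def)
    qed
    then show "eventually (\<lambda>h. y < a h (trunc h t)) sequentially"
      using eventually_at_top_linorder by blast
  next
    fix y assume "g t < y"
    then show "eventually (\<lambda>h. a h (trunc h t) < y) sequentially"
      using a_le[of _ t] by (intro always_eventually allI) (meson le_less_trans)
  qed
  interpret N: prob_space N by fact
  have measN: "f \<in> borel_measurable N" if "f \<in> borel_measurable borel" for f :: "tree \<Rightarrow> real"
    using that N(2) measurable_cong_sets by blast
  \<comment> \<open>As \<open>c\<close> lies strictly below the integral of \<open>g\<close>, there is room to fix a height \<open>h\<close> and
    then finitely many trees.\<close>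
  have "(\<lambda>h. \<integral>t. a h (trunc h t) \<partial>N) \<longlonglongrightarrow> (\<integral>t. g t \<partial>N)"
    by (rule integral_dominated_convergence[where w = "\<lambda>_. K"])
      (use lim_a a_nonneg a_le_K in \<open>auto intro!: measN meas_g meas_a\<close>)
  then have "eventually (\<lambda>h. c < (\<integral>t. a h (trunc h t) \<partial>N)) sequentially"
    using c by (rule order_tendstoD)
  then have "eventually (\<lambda>h. 1 \<le> h \<and> c < (\<integral>t. a h (trunc h t) \<partial>N)) sequentially"
    by (intro eventually_conj eventually_ge_at_top)
  then obtain h where h: "1 \<le> h" "c < (\<integral>t. a h (trunc h t) \<partial>N)"
    using eventually_happens'[of sequentially] by auto
  define E where "E m = from_nat_into {s. finite_tree s} ` {..m}" for m :: nat
  define f where "f m s = (if s \<in> E m then a h s else 0)" for m s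
  have lim_f: "(\<lambda>m. f m (trunc h t)) \<longlonglongrightarrow> a h (trunc h t)" for t
  proof -
    obtain i where i: "from_nat_into {s. finite_tree s} i = trunc h t"
      using from_nat_into_surj[OF countable_finite_trees, of "trunc h t"] finite_tree_trunc
      by auto
    have "f m (trunc h t) = a h (trunc h t)" if "i \<le> m" for m
      unfolding f_def E_def using i that by (metis atMost_iff imageI)
    then have "eventually (\<lambda>m. f m (trunc h t) = a h (trunc h t)) sequentially"
      using eventually_at_top_linorder by blast
    then show ?thesis by (rule tendsto_eventually)
  qed
  have f_nonneg: "0 \<le> f m s" for m s using a_nonneg by (simp add: f_def)
  have f_le: "f m (trunc h t) \<le> a h (trunc h t)" for m t using a_nonneg by (simp add: f_def)
  have meas_f: "(\<lambda>t. f m (trunc h t)) \<in> borel_measurable borel" for m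
    by (rule borel_measurable_of_trunc)
  have f_le_K: "f m (trunc h t) \<le> K" for m t using f_le a_le_K order_trans by blast
  have "(\<lambda>m. \<integral>t. f m (trunc h t) \<partial>N) \<longlonglongrightarrow> (\<integral>t. a h (trunc h t) \<partial>N)"
    by (rule integral_dominated_convergence[where w = "\<lambda>_. K"])
      (use lim_f f_nonneg f_le_K in \<open>auto intro!: measN meas_f meas_a\<close>)
  then have "eventually (\<lambda>m. c < (\<integral>t. f m (trunc h t) \<partial>N)) sequentially"
    using h(2) by (rule order_tendstoD)
  then obtain m where m: "c < (\<integral>t. f m (trunc h t) \<partial>N)"
    using eventually_happens'[of sequentially] by auto
  have fin: "finite (E m)" by (simp add: E_def)
  have f_sum: "f m (trunc h t) = (\<Sum>s\<in>E m. a h s * indicator (cyl h s) t)" for t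
  proof -
    have "(\<Sum>s\<in>E m. a h s * indicator (cyl h s) t) =
        (\<Sum>s\<in>E m. if trunc h t = s then a h s else 0)"
      by (intro sum.cong refl) (simp add: cyl_def)
    then show ?thesis using fin by (simp add: f_def)
  qed
  have int_f: "(\<integral>t. f m (trunc h t) \<partial>Q) = (\<Sum>s\<in>E m. a h s * measure Q (cyl h s))"
    if "prob_space Q" "sets Q = sets borel" for Q
  proof -
    interpret Q: prob_space Q by fact
    have S: "cyl h s \<in> sets Q" for s using that by (simp add: cyl_def sets_cylinder)
    have "space Q = UNIV" using sets_eq_imp_space_eq[OF that(2)] by simp
    then show ?thesis unfolding f_sum
      using S by (subst Bochner_Integration.integral_sum) (auto simp: Q.emeasure_eq_measure)
  qed
  have "c < (\<Sum>s\<in>E m. a h s * measure N (cyl h s))"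
    using m int_f[OF N] by simp
  then have "eventually (\<lambda>n. c < (\<Sum>s\<in>E m. a h s * measure (L n) (cyl h s))) F"
    using h(1) by (intro eventually_less_weighted_sum fin a_nonneg) (auto simp: cyl_def lower)
  with L show ?thesis
  proof eventually_elim
    case (elim n)
    interpret Q: prob_space "L n" using elim by simp
    have measQ: "f \<in> borel_measurable (L n)" if "f \<in> borel_measurable borel" for f :: "tree \<Rightarrow> real"
      using that elim(1) measurable_cong_sets by blast
    have int: "integrable (L n) f"
      if "f \<in> borel_measurable borel" "\<And>t. 0 \<le> f t" "\<And>t. f t \<le> K" for f :: "tree \<Rightarrow> real"
      by (rule Q.integrable_const_bound[where B = K]) (use that in \<open>auto intro!: measQ\<close>)
    have "c < (\<integral>t. f m (trunc h t) \<partial>L n)" using elim int_f[of "L n"] by simp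
    also have "\<dots> \<le> (\<integral>t. g t \<partial>L n)"
      by (intro integral_mono int meas_f meas_g f_nonneg f_le_K g order_trans[OF f_le a_le])
    finally show ?case .
  qed
qed

text \<open>Lower bounds suffice because the limit is a probability measure: applying lower
  semicontinuity to \<open>K + f\<close> and to \<open>K - f\<close> gives both bounds for \<open>f\<close>.\<close>

lemma converges_in_law_if_cylinders:
  fixes L :: "nat \<Rightarrow> tree measure"
  assumes L: "eventually (\<lambda>n. prob_space (L n) \<and> sets (L n) = sets borel) F"
    and N: "prob_space N" "sets N = sets borel"
    and lower: "\<And>h s x. 1 \<le> h \<Longrightarrow> x < measure N {t. trunc h t = s} \<Longrightarrow>
      eventually (\<lambda>n. x < measure (L n) {t. trunc h t = s}) F"
  shows "converges_in_law L N F"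
  unfolding converges_in_law_def
proof (intro allI impI)
  fix f :: "tree \<Rightarrow> real" assume cont: "continuous_on UNIV f" and "bounded (range f)"
  then obtain K where K: "\<And>t. \<bar>f t\<bar> \<le> K" unfolding bounded_iff by auto
  have int: "integrable Q f" if "prob_space Q" "sets Q = sets borel" for Q
  proof -
    interpret Q: prob_space Q by fact
    have "f \<in> borel_measurable Q"
      using borel_measurable_continuous_onI[OF cont] that(2) measurable_cong_sets by blast
    then show ?thesis using K by (intro Q.integrable_const_bound[where B = K]) auto
  qed
  have shift: "(\<integral>t. K + e * f t \<partial>Q) = K + e * (\<integral>t. f t \<partial>Q)"
    if "prob_space Q" "sets Q = sets borel" for Q and e :: real
  proof -
    interpret Q: prob_space Q by fact
    show ?thesis using int[OF that] by (simp add: Q.prob_space)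
  qed
  have K2: "0 \<le> K + e * f t" "K + e * f t \<le> 2 * K" if "e \<in> {-1, 1}" for e t
    using K[of t] that by (auto simp: abs_le_iff)
  have ev: "eventually (\<lambda>n. c < e * (\<integral>t. f t \<partial>L n)) F"
    if e: "e \<in> {-1, 1}" and c: "c < e * (\<integral>t. f t \<partial>N)" for c e :: real
  proof -
    have "eventually (\<lambda>n. K + c < (\<integral>t. K + e * f t \<partial>L n)) F"
      by (rule eventually_less_integral[OF L N lower _ K2[OF e]])
        (use c in \<open>auto simp: shift[OF N] intro!: continuous_intros cont\<close>)
    with L show ?thesis by eventually_elim (simp add: shift)
  qed
  show "((\<lambda>n. \<integral>t. f t \<partial>L n) \<longlongrightarrow> (\<integral>t. f t \<partial>N)) F"
  proof (rule order_tendstoI)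
    fix y assume "y < (\<integral>t. f t \<partial>N)"
    then show "eventually (\<lambda>n. y < (\<integral>t. f t \<partial>L n)) F" using ev[of 1 y] by simp
  next
    fix y assume "(\<integral>t. f t \<partial>N) < y"
    then show "eventually (\<lambda>n. (\<integral>t. f t \<partial>L n) < y) F" using ev[of "-1" "-y"] by simp
  qed
qed

section \<open>Galton--Watson trees\<close>

text \<open>The product of the offspring probabilities of the nodes of \<open>s\<close> below height \<open>b\<close>. If \<open>s\<close> has
  height at most \<open>b\<close>, this is the probability that a Galton--Watson tree truncated at height \<open>b\<close>
  equals \<open>s\<close>.\<close>

definition tree_weight :: "nat pmf \<Rightarrow> nat \<Rightarrow> tree \<Rightarrow> real" where
  "tree_weight p b s = (\<Prod>w\<in>{w \<in> nodes s. length w < b}. pmf p (outdeg s w))"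

lemma tree_weight_nonneg: "0 \<le> tree_weight p b s"
  by (simp add: tree_weight_def prod_nonneg)

lemma singleton_child_in_nodes: "i \<in> {1..outdeg s []} \<Longrightarrow> [i] \<in> nodes s"
  using child_in_nodes_iff[of "[]" s i] by simp

lemma tree_weight_Suc:
  "tree_weight p (Suc b) s =
    pmf p (outdeg s []) * (\<Prod>i\<in>{1..outdeg s []}. tree_weight p b (subtree s [i]))"
proof -
  have fin: "finite {w \<in> nodes s. length w < Suc b}" by (rule finite_words_below)
  have "{w \<in> nodes s. length w < Suc b} = insert [] {w \<in> nodes s. w \<noteq> [] \<and> length w < Suc b}"
    by auto
  then have "tree_weight p (Suc b) s = pmf p (outdeg s []) *
      (\<Prod>w\<in>{w \<in> nodes s. w \<noteq> [] \<and> length w < Suc b}. pmf p (outdeg s w))"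
    using fin by (simp add: tree_weight_def)
  also have "(\<Prod>w\<in>{w \<in> nodes s. w \<noteq> [] \<and> length w < Suc b}. pmf p (outdeg s w)) =
      (\<Prod>i\<in>{1..outdeg s []}. tree_weight p b (subtree s [i]))"
    unfolding prod_nodes_split[OF fin] tree_weight_def
    by (intro prod.cong) (auto simp: outdeg_subtree singleton_child_in_nodes)
  finally show ?thesis .
qed

lemma sets_trunc_subtrees:
  assumes "\<And>u. C u \<in> sets borel"
  shows "{t. trunc b t = s \<and> (\<forall>u\<in>nodes s'. length u = b \<longrightarrow> subtree t u \<in> C u)} \<in> sets borel"
proof -
  let ?U = "{u \<in> nodes s'. length u = b}"
  have "{t \<in> space borel. trunc b t = s \<and> (\<forall>u\<in>?U. subtree t u \<in> C u)} \<in> sets borel"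
  proof (intro sets.sets_Collect_conj sets.sets_Collect_finite_All)
    show "{t \<in> space borel. trunc b t = s} \<in> sets borel" using sets_cylinder by simp
    show "{t \<in> space borel. subtree t u \<in> C u} \<in> sets borel" for u
      using measurable_sets[OF measurable_subtree[of u] assms[of u]] by (simp add: vimage_def)
    show "finite ?U" by (rule finite_words_of_length)
  qed
  moreover have "{t \<in> space borel. trunc b t = s \<and> (\<forall>u\<in>?U. subtree t u \<in> C u)} =
      {t. trunc b t = s \<and> (\<forall>u\<in>nodes s'. length u = b \<longrightarrow> subtree t u \<in> C u)}" by auto
  ultimately show ?thesis by simp
qed

text \<open>The branching property at height \<open>b\<close>: given its first \<open>b\<close> generations, the subtrees
  above height \<open>b\<close> are independent copies of the tree.\<close>

lemma galton_watson_branching: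
  assumes gw: "galton_watson p M \<tau>" and M: "prob_space M"
    and "\<And>u. C u \<in> sets borel" and "height s \<le> enat b"
  shows "\<P>(\<omega> in M. trunc b (\<tau> \<omega>) = s \<and> (\<forall>u\<in>nodes s. length u = b \<longrightarrow> subtree (\<tau> \<omega>) u \<in> C u)) =
    tree_weight p b s * (\<Prod>u\<in>{u \<in> nodes s. length u = b}. \<P>(\<omega> in M. \<tau> \<omega> \<in> C u))"
  using assms(3,4)
proof (induction b arbitrary: s C)
  case 0
  then have "\<forall>u\<in>nodes s. u = []" by (auto simp: height_le_iff)
  then have words: "{u \<in> nodes s. length u = 0} = {[]}" "{w \<in> nodes s. length w < 0} = {}" by auto
  have "trunc 0 t = s" for t
    using \<open>\<forall>u\<in>nodes s. u = []\<close> by (intro tree_eqI) (auto simp: nodes_trunc)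
  then show ?case unfolding tree_weight_def words by simp
next
  case (Suc b)
  let ?k = "outdeg s []" and ?s = "\<lambda>i. subtree s [i]"
  define D where "D i = {t. trunc b t = ?s i \<and>
    (\<forall>u\<in>nodes (?s i). length u = b \<longrightarrow> subtree t u \<in> C (i # u))}" for i
  have D: "D i \<in> sets borel" for i
    unfolding D_def by (rule sets_trunc_subtrees) (rule Suc.prems)
  have event: "trunc (Suc b) t = s \<and> (\<forall>u\<in>nodes s. length u = Suc b \<longrightarrow> subtree t u \<in> C u) \<longleftrightarrow>
      outdeg t [] = ?k \<and> (\<forall>i\<in>{1..?k}. subtree t [i] \<in> D i)" (is "?l \<longleftrightarrow> ?r") for t
  proof -
    have sub: "subtree (subtree t [i]) w = subtree t (i # w)"
      if "outdeg t [] = ?k" "i \<in> {1..?k}" for i w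
      using subtree_subtree[of "[i]" t w] singleton_child_in_nodes[of i t] that by simp
    have "(\<forall>u\<in>nodes s. length u = Suc b \<longrightarrow> subtree t u \<in> C u) \<longleftrightarrow>
      (\<forall>i\<in>{1..?k}. \<forall>w\<in>nodes (?s i). length w = b \<longrightarrow> subtree (subtree t [i]) w \<in> C (i # w))"
      if deg: "outdeg t [] = ?k"
    proof (intro iffI ballI impI)
      fix i w
      assume "\<forall>u\<in>nodes s. length u = Suc b \<longrightarrow> subtree t u \<in> C u"
        and iw: "i \<in> {1..?k}" "w \<in> nodes (?s i)" "length w = b"
      moreover have "i # w \<in> nodes s" using iw by (simp add: Cons_in_nodes_iff)
      ultimately have "subtree t (i # w) \<in> C (i # w)" by simp
      then show "subtree (subtree t [i]) w \<in> C (i # w)" by (simp add: sub[OF deg iw(1)])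
    next
      fix u
      assume all: "\<forall>i\<in>{1..?k}. \<forall>w\<in>nodes (?s i). length w = b \<longrightarrow>
          subtree (subtree t [i]) w \<in> C (i # w)"
        and u: "u \<in> nodes s" "length u = Suc b"
      then obtain i w where iw: "u = i # w" by (cases u) auto
      then have "i \<in> {1..?k}" "w \<in> nodes (?s i)" "length w = b"
        using u by (simp_all add: Cons_in_nodes_iff)
      then show "subtree t u \<in> C u" using all sub[OF deg] iw by metis
    qed
    then show ?thesis
      unfolding trunc_Suc_eq_iff_subtrees[OF Suc.prems(2)] D_def by blast
  qed
  have IH: "\<P>(\<omega> in M. \<tau> \<omega> \<in> D i) = tree_weight p b (?s i) *
      (\<Prod>u\<in>{u \<in> nodes (?s i). length u = b}. \<P>(\<omega> in M. \<tau> \<omega> \<in> C (i # u)))" if "i \<in> {1..?k}" for i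
    using Suc.IH[of "\<lambda>u. C (i # u)" "?s i"] Suc.prems(1)
      height_subtree[OF Suc.prems(2) singleton_child_in_nodes[OF that]]
    by (simp add: D_def)
  have "\<P>(\<omega> in M. trunc (Suc b) (\<tau> \<omega>) = s \<and>
      (\<forall>u\<in>nodes s. length u = Suc b \<longrightarrow> subtree (\<tau> \<omega>) u \<in> C u)) =
    \<P>(\<omega> in M. outdeg (\<tau> \<omega>) [] = ?k \<and> (\<forall>i\<in>{1..?k}. subtree (\<tau> \<omega>) [i] \<in> D i))"
    unfolding event ..
  also have "\<dots> = pmf p ?k * (\<Prod>i\<in>{1..?k}. \<P>(\<omega> in M. \<tau> \<omega> \<in> D i))"
    using gw D unfolding galton_watson_def by blast
  also have "\<dots> = tree_weight p (Suc b) s * (\<Prod>i\<in>{1..?k}.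
      \<Prod>u\<in>{u \<in> nodes (?s i). length u = b}. \<P>(\<omega> in M. \<tau> \<omega> \<in> C (i # u)))"
    by (simp add: IH prod.distrib tree_weight_Suc)
  also have "(\<Prod>i\<in>{1..?k}. \<Prod>u\<in>{u \<in> nodes (?s i). length u = b}. \<P>(\<omega> in M. \<tau> \<omega> \<in> C (i # u))) =
      (\<Prod>u\<in>{u \<in> nodes s. length u = Suc b}. \<P>(\<omega> in M. \<tau> \<omega> \<in> C u))"
  proof -
    have words: "{u \<in> nodes s. length u = Suc b} = {u \<in> nodes s. u \<noteq> [] \<and> length u = Suc b}"
      by auto
    show ?thesis
      unfolding words prod_nodes_split[OF finite_words_of_length[of s "Suc b"]] length_Cons nat.inject ..
  qed
  finally show ?case .
qed

lemma galton_watson_finite_tree: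
  assumes gw: "galton_watson p M \<tau>" and M: "prob_space M" and s: "height s \<le> enat b"
  shows "\<P>(\<omega> in M. \<tau> \<omega> = s) = tree_weight p (Suc b) s"
proof -
  interpret prob_space M by fact
  have "height s \<le> enat (Suc b)" using s by (auto simp: height_le_iff le_SucI)
  from galton_watson_branching[OF gw M _ this, of "\<lambda>_. UNIV"] show ?thesis
    by (simp add: trunc_Suc_eq_iff[OF s] prob_space)
qed

text \<open>The branching property determines the law of the tree on finite trees. No almost sure
  finiteness is needed, as the events in question only involve finite trees.\<close>

lemma galton_watson_unique:
  assumes "galton_watson p M \<tau>" "prob_space M" "galton_watson p M' \<tau>'" "prob_space M'"
    and "finite_tree s"
  shows "\<P>(\<omega> in M. \<tau> \<omega> = s) = \<P>(\<omega> in M'. \<tau>' \<omega> = s)"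
  using finite_tree_height[OF assms(5)] galton_watson_finite_tree assms(1-4) by metis

text \<open>The forest above height \<open>b\<close> of a tree with truncation \<open>s\<close> consists of independent
  copies of the tree, one for each node of \<open>s\<close> at height \<open>b\<close>.\<close>

lemma galton_watson_forest_above:
  assumes gw: "galton_watson p M \<tau>" and M: "prob_space M"
    and gwT: "\<And>i. galton_watson p M (T i)" and indep: "prob_space.indep_vars M (\<lambda>_. borel) T UNIV"
    and s: "height s \<le> enat b" and k: "k = card {u \<in> nodes s. length u = b}" "1 \<le> k"
    and L: "\<And>ts. ts \<in> L \<Longrightarrow> length ts = k \<and> (\<forall>t\<in>set ts. finite_tree t)"
  shows "\<P>(\<omega> in M. trunc b (\<tau> \<omega>) = s \<and> forest_above b (\<tau> \<omega>) \<in> L) =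
      tree_weight p b s * \<P>(\<omega> in M. map (\<lambda>i. T i \<omega>) [1..<Suc k] \<in> L)"
proof -
  interpret prob_space M by fact
  let ?us = "level b s"
  have len: "length ?us = k" by (simp add: k length_level)
  have meas: "\<tau> \<in> borel_measurable M" "T i \<in> borel_measurable M" for i
    using gw gwT by (auto simp: galton_watson_def)
  define X where "X ts = {\<omega> \<in> space M. trunc b (\<tau> \<omega>) = s \<and> forest_above b (\<tau> \<omega>) = ts}" for ts
  define Y where "Y ts = {\<omega> \<in> space M. map (\<lambda>i. T i \<omega>) [1..<Suc k] = ts}" for ts
  have "L \<subseteq> lists {t. finite_tree t}" using L by auto
  then have count: "countable L"
    by (rule countable_subset) (intro countable_lists countable_finite_trees)
  have key: "X ts \<in> sets M \<and> Y ts \<in> sets M \<and> measure M (X ts) = tree_weight p b s * measure M (Y ts)"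
    if "ts \<in> L" for ts
  proof -
    have ts: "length ts = k" "\<And>i. i < k \<Longrightarrow> finite_tree (ts ! i)" using L[OF that] by auto
    \<comment> \<open>\<open>C u\<close> prescribes the tree of \<open>ts\<close> at the position of \<open>u\<close> among the nodes at height \<open>b\<close>.\<close>
    define C where "C u = {the (map_of (zip ?us ts) u)}" for u
    have C: "C u \<in> sets borel" for u by (simp add: C_def)
    have C_nth: "C (?us ! i) = {ts ! i}" if "i < k" for i
      using that len ts(1) by (simp add: C_def map_of_zip_nth)
    have X_eq: "X ts = {\<omega> \<in> space M. trunc b (\<tau> \<omega>) = s \<and>
        (\<forall>u\<in>nodes s. length u = b \<longrightarrow> subtree (\<tau> \<omega>) u \<in> C u)}"
    proof -
      have "forest_above b t = ts \<longleftrightarrow> (\<forall>u\<in>nodes s. length u = b \<longrightarrow> subtree t u \<in> C u)"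
        if "trunc b t = s" for t
      proof -
        have level: "level b t = ?us" using level_trunc[of b t] that by simp
        have "forest_above b t = ts \<longleftrightarrow> (\<forall>i<k. subtree t (?us ! i) \<in> C (?us ! i))"
          unfolding forest_above_def level list_eq_iff_nth_eq[of "map (subtree t) ?us" ts]
          by (simp add: len ts C_nth)
        also have "\<dots> \<longleftrightarrow> (\<forall>u\<in>set ?us. subtree t u \<in> C u)"
          unfolding all_set_conv_all_nth len ..
        finally show ?thesis unfolding set_level by blast
      qed
      then show ?thesis unfolding X_def by blast
    qed
    have "X ts \<in> sets M"
    proof -
      have "X ts = \<tau> -` {t. trunc b t = s \<and>
          (\<forall>u\<in>nodes s. length u = b \<longrightarrow> subtree t u \<in> C u)} \<inter> space M"
        unfolding X_eq by auto
      then show ?thesis using measurable_sets[OF meas(1) sets_trunc_subtrees[OF C]] by simp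
    qed
    moreover have "measure M (X ts) = tree_weight p b s * (\<Prod>i<k. \<P>(\<omega> in M. \<tau> \<omega> = ts ! i))"
    proof -
      have bij: "bij_betw ((!) ?us) {..<k} {u \<in> nodes s. length u = b}"
        using bij_betw_nth[of ?us "{..<k}" "set ?us"] len by simp
      have "(\<Prod>u\<in>{u \<in> nodes s. length u = b}. \<P>(\<omega> in M. \<tau> \<omega> \<in> C u)) =
          (\<Prod>i<k. \<P>(\<omega> in M. \<tau> \<omega> \<in> C (?us ! i)))"
        by (rule prod.reindex_bij_betw[OF bij, symmetric])
      then show ?thesis
        unfolding X_eq galton_watson_branching[OF gw M C s] by (simp add: C_nth)
    qed
    moreover have Y_eq: "Y ts = (\<Inter>i\<in>{1..k}. T i -` {ts ! (i - 1)} \<inter> space M)"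
    proof -
      have "map (\<lambda>i. T i \<omega>) [1..<Suc k] = ts \<longleftrightarrow> (\<forall>j<k. T (Suc j) \<omega> = ts ! j)" for \<omega>
        by (auto simp: list_eq_iff_nth_eq ts simp del: upt_Suc)
      also have "\<dots> \<omega> \<longleftrightarrow> (\<forall>i\<in>{1..k}. T i \<omega> = ts ! (i - 1))" for \<omega>
        by (metis One_nat_def Suc_le_eq Suc_pred atLeastAtMost_iff diff_Suc_1 le_add1 plus_1_eq_Suc)
      finally show ?thesis using k(2) by (auto simp: Y_def)
    qed
    moreover have "Y ts \<in> sets M"
      unfolding Y_eq using k(2) by (intro sets.finite_INT measurable_sets[OF meas(2)]) auto
    moreover have "measure M (Y ts) = (\<Prod>i<k. \<P>(\<omega> in M. \<tau> \<omega> = ts ! i))"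
    proof -
      have "measure M (Y ts) = (\<Prod>i\<in>{1..k}. prob (T i -` {ts ! (i - 1)} \<inter> space M))"
        unfolding Y_eq using k(2) by (intro indep_varsD[OF indep]) auto
      also have "\<dots> = (\<Prod>i<k. prob (T (Suc i) -` {ts ! i} \<inter> space M))"
        by (simp add: prod.atLeast1_atMost_eq)
      also have "\<dots> = (\<Prod>i<k. \<P>(\<omega> in M. \<tau> \<omega> = ts ! i))"
      proof (intro prod.cong refl)
        fix i assume "i \<in> {..<k}"
        then have "\<P>(\<omega> in M. T (Suc i) \<omega> = ts ! i) = \<P>(\<omega> in M. \<tau> \<omega> = ts ! i)"
          using galton_watson_unique[OF gwT M gw M ts(2)] by simp
        moreover have "T (Suc i) -` {ts ! i} \<inter> space M = {\<omega> \<in> space M. T (Suc i) \<omega> = ts ! i}" by auto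
        ultimately show "prob (T (Suc i) -` {ts ! i} \<inter> space M) = \<P>(\<omega> in M. \<tau> \<omega> = ts ! i)" by simp
      qed
      finally show ?thesis .
    qed
    ultimately show ?thesis by simp
  qed
  have UX: "{\<omega> \<in> space M. trunc b (\<tau> \<omega>) = s \<and> forest_above b (\<tau> \<omega>) \<in> L} = (\<Union>ts\<in>L. X ts)"
    and UY: "{\<omega> \<in> space M. map (\<lambda>i. T i \<omega>) [1..<Suc k] \<in> L} = (\<Union>ts\<in>L. Y ts)"
    by (auto simp: X_def Y_def)
  have disj: "disjoint_family_on X L" "disjoint_family_on Y L"
    by (auto simp: disjoint_family_on_def X_def Y_def)
  have "emeasure M (\<Union>ts\<in>L. X ts) = (\<integral>\<^sup>+ts. emeasure M (X ts) \<partial>count_space L)"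
    using key count disj by (intro emeasure_UN_countable) auto
  also have "\<dots> = (\<integral>\<^sup>+ts. ennreal (tree_weight p b s) * emeasure M (Y ts) \<partial>count_space L)"
    using key by (intro nn_integral_cong)
      (simp add: emeasure_eq_measure ennreal_mult tree_weight_nonneg)
  also have "\<dots> = ennreal (tree_weight p b s) * (\<integral>\<^sup>+ts. emeasure M (Y ts) \<partial>count_space L)"
    by (rule nn_integral_cmult) simp
  also have "(\<integral>\<^sup>+ts. emeasure M (Y ts) \<partial>count_space L) = emeasure M (\<Union>ts\<in>L. Y ts)"
    using key count disj by (intro emeasure_UN_countable[symmetric]) auto
  finally have "measure M (\<Union>ts\<in>L. X ts) = tree_weight p b s * measure M (\<Union>ts\<in>L. Y ts)"
    by (simp add: emeasure_eq_measure tree_weight_nonneg flip: ennreal_mult)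
  then show ?thesis unfolding UX UY .
qed

section \<open>The immortal tree\<close>

lemma pmf_size_biased:
  assumes "integrable (measure_pmf p) real" "0 < offspring_mean p"
  shows "pmf (size_biased p) k = real k * pmf p k / offspring_mean p"
  unfolding size_biased_def
proof (rule pmf_embed_pmf)
  let ?m = "offspring_mean p"
  show "0 \<le> real x * pmf p x / ?m" for x using assms by simp
  have "(\<integral>\<^sup>+x. ennreal (real x * pmf p x / ?m) \<partial>count_space UNIV) =
      (\<integral>\<^sup>+x. ennreal (pmf p x) * ennreal (real x / ?m) \<partial>count_space UNIV)"
    using assms by (intro nn_integral_cong) (simp add: mult.commute flip: ennreal_mult)
  also have "\<dots> = (\<integral>\<^sup>+x. ennreal (real x / ?m) \<partial>measure_pmf p)"
    by (simp add: nn_integral_measure_pmf)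
  also have "\<dots> = ennreal (\<integral>x. real x / ?m \<partial>measure_pmf p)"
    using assms by (intro nn_integral_eq_integral) auto
  also have "(\<integral>x. real x / ?m \<partial>measure_pmf p) = 1"
    using assms by (simp add: offspring_mean_def)
  finally show "(\<integral>\<^sup>+x. ennreal (real x * pmf p x / ?m) \<partial>count_space UNIV) = 1" by simp
qed

lemma pmf_special:
  assumes p: "integrable (measure_pmf p) real" "0 < offspring_mean p" and j: "1 \<le> j" "j \<le> k"
  shows "pmf (special_pmf p) (k, j) = pmf p k / offspring_mean p"
proof -
  have "pmf (map_pmf (Pair k') (pmf_of_set {1..k'})) (k, j) = indicator {k} k' * (1 / real k)" for k'
  proof (cases "k' = k")
    case True
    have "pmf (map_pmf (Pair k) (pmf_of_set {1..k})) (k, j) = pmf (pmf_of_set {1..k}) j"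
      by (rule pmf_map_inj') (simp add: inj_on_def)
    then show ?thesis using True j by (simp add: pmf_of_set)
  next
    case False
    then have "(k, j) \<notin> Pair k' ` set_pmf (pmf_of_set {1..k'})" by auto
    then show ?thesis using False by (simp add: pmf_map_outside)
  qed
  then have "pmf (special_pmf p) (k, j) = (\<integral>k'. indicator {k} k' * (1 / real k) \<partial>size_biased p)"
    by (simp add: special_pmf_def pmf_bind)
  also have "\<dots> = pmf (size_biased p) k * (1 / real k)"
    by (simp add: measure_pmf_single)
  also have "\<dots> = pmf p k / offspring_mean p"
    using j by (simp add: pmf_size_biased[OF p])
  finally show ?thesis .
qed

lemma set_special_pmf:
  assumes p: "integrable (measure_pmf p) real" "0 < offspring_mean p" and "x \<in> set_pmf (special_pmf p)"
  shows "1 \<le> snd x \<and> snd x \<le> fst x"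
proof -
  obtain k j where k: "k \<in> set_pmf (size_biased p)" and j: "j \<in> set_pmf (pmf_of_set {1..k})"
    and x: "x = (k, j)" using assms(3) by (auto simp: special_pmf_def)
  have "k \<noteq> 0" using k pmf_size_biased[OF p, of k] by (auto simp: set_pmf_eq)
  then show ?thesis using j x by (simp add: set_pmf_of_set)
qed

lemma prob_space_marks_law: "prob_space (marks_law p)"
  unfolding marks_law_def by (intro prob_space_PiM measure_pmf.prob_space_axioms)

lemma space_marks_law [simp]: "space (marks_law p) = UNIV"
  by (simp add: marks_law_def space_PiM)

lemma measurable_mark: "(\<lambda>\<omega>. f (\<omega> w)) \<in> measurable (marks_law p) (count_space UNIV)"
  unfolding marks_law_def
  by (rule measurable_compose[OF measurable_component_singleton]) auto

lemma measurable_is_special: "Measurable.pred (marks_law p) (\<lambda>\<omega>. is_special \<omega> u)"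
  unfolding is_special_def by (intro pred_intros_countable) (rule measurable_mark)

lemma measurable_offspring: "(\<lambda>\<omega>. offspring \<omega> u) \<in> measurable (marks_law p) (count_space UNIV)"
  unfolding offspring_def
  by (intro measurable_If measurable_mark) (use measurable_is_special in \<open>simp add: pred_def\<close>)

lemma measurable_immortal_tree: "immortal_tree \<in> borel_measurable (marks_law p)"
proof (rule borel_measurable_treeI)
  fix h s
  have node: "Measurable.pred (marks_law p) (\<lambda>\<omega>. u \<in> nodes (immortal_tree \<omega>))" for u
    unfolding nodes_immortal_tree mem_Collect_eq
    by (intro pred_intros_countable) (rule measurable_compose[OF measurable_offspring], simp)
  have "trunc h t = s \<longleftrightarrow> (\<forall>u. u \<in> nodes s \<longleftrightarrow> length u \<le> h \<and> u \<in> nodes t)" for t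
    by (auto simp: nodes_inject[symmetric] nodes_trunc)
  moreover have "Measurable.pred (marks_law p)
      (\<lambda>\<omega>. \<forall>u. u \<in> nodes s \<longleftrightarrow> length u \<le> h \<and> u \<in> nodes (immortal_tree \<omega>))"
    using node by measurable
  ultimately show "{\<omega> \<in> space (marks_law p). trunc h (immortal_tree \<omega>) = s} \<in> sets (marks_law p)"
    by (simp add: pred_def)
qed

lemma prob_space_immortal_law: "prob_space (immortal_law p)"
  unfolding immortal_law_def
  by (intro prob_space.prob_space_distr prob_space_marks_law measurable_immortal_tree)

lemma outdeg_immortal_tree:
  assumes "u \<in> nodes (immortal_tree \<omega>)"
  shows "outdeg (immortal_tree \<omega>) u = offspring \<omega> u"
proof -
  have children: "u @ [i] \<in> nodes (immortal_tree \<omega>) \<longleftrightarrow> 1 \<le> i \<and> i \<le> offspring \<omega> u" for i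
    using assms unfolding nodes_immortal_tree by (auto simp: nth_append less_Suc_eq)
  have "{i. u @ [i] \<in> nodes (immortal_tree \<omega>)} = {1..offspring \<omega> u}" by (auto simp add: children)
  then show ?thesis by (simp add: outdeg_def)
qed

lemma outdeg_trunc: "length u < b \<Longrightarrow> outdeg (trunc b t) u = outdeg t u"
  by (simp add: outdeg_def nodes_trunc Suc_le_eq)

lemma is_special_append:
  "is_special \<omega> (u @ [j]) \<longleftrightarrow> is_special \<omega> u \<and> j = snd (snd (\<omega> u))"
  by (auto simp: is_special_def nth_append less_Suc_eq)

lemma is_special_take: "is_special \<omega> u \<Longrightarrow> is_special \<omega> (take i u)"
  by (auto simp: is_special_def min_def)

lemma is_special_unique:
  assumes "is_special \<omega> u" "is_special \<omega> w" "length w = length u"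
  shows "w = u"
  using assms(3,1,2)
proof (induction w u rule: rev_induct2)
  case (4 x xs y ys)
  then show ?case by (simp add: is_special_append)
qed simp_all

text \<open>If every mark has a special child within range, which holds almost surely, the special nodes
  form an infinite line of descent.\<close>

lemma special_node_at_height:
  assumes "\<And>w. 1 \<le> snd (snd (\<omega> w)) \<and> snd (snd (\<omega> w)) \<le> fst (snd (\<omega> w))"
  shows "\<exists>u\<in>nodes (immortal_tree \<omega>). length u = b \<and> is_special \<omega> u"
proof (induction b)
  case 0
  then show ?case by (intro bexI[of _ "[]"]) (auto simp: is_special_def)
next
  case (Suc b)
  then obtain u where u: "u \<in> nodes (immortal_tree \<omega>)" "length u = b" "is_special \<omega> u" by blast
  let ?j = "snd (snd (\<omega> u))"
  have "outdeg (immortal_tree \<omega>) u = fst (snd (\<omega> u))"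
    using u by (simp add: outdeg_immortal_tree offspring_def)
  then have "u @ [?j] \<in> nodes (immortal_tree \<omega>)"
    using assms[of u] u(1) by (simp add: child_in_nodes_iff)
  moreover have "is_special \<omega> (u @ [?j])" using u by (simp add: is_special_append)
  ultimately show ?case using u(2) by (intro bexI[of _ "u @ [?j]"]) auto
qed

text \<open>The values of the marks for which the first \<open>b\<close> generations of the immortal tree are
  those of \<open>s\<close>, with \<open>u\<close> as special node at height \<open>b\<close>.\<close>

definition spine_mark :: "tree \<Rightarrow> nat list \<Rightarrow> nat list \<Rightarrow> (nat \<times> (nat \<times> nat)) set" where
  "spine_mark s u w = (if w = take (length w) u then {x. snd x = (outdeg s w, u ! length w)}
    else {x. fst x = outdeg s w})"

lemma measure_spine_mark:
  assumes p: "integrable (measure_pmf p) real" "0 < offspring_mean p"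
    and u: "u \<in> nodes s" "length w < length u"
  shows "measure (measure_pmf (pair_pmf p (special_pmf p))) (spine_mark s u w) =
    pmf p (outdeg s w) * (if w = take (length w) u then 1 / offspring_mean p else 1)"
proof (cases "w = take (length w) u")
  case True
  have "take (Suc (length w)) u = w @ [u ! length w]"
    using True u(2) by (simp add: take_Suc_conv_app_nth)
  moreover have "take (Suc (length w)) u \<in> nodes s"
    using nodes_prefix[of "take (Suc (length w)) u" "drop (Suc (length w)) u" s] u(1) by simp
  ultimately have "w @ [u ! length w] \<in> nodes s" by simp
  then have "1 \<le> u ! length w \<and> u ! length w \<le> outdeg s w"
    using nodes_prefix child_in_nodes_iff by blast
  then have "pmf (special_pmf p) (outdeg s w, u ! length w) = pmf p (outdeg s w) / offspring_mean p"
    using pmf_special[OF p] by blast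
  moreover have "pmf (special_pmf p) (outdeg s w, u ! length w) =
      measure (measure_pmf (pair_pmf p (special_pmf p))) (snd -` {(outdeg s w, u ! length w)})"
    by (subst map_snd_pair_pmf[symmetric, of _ p]) (rule pmf_map)
  moreover have "spine_mark s u w = snd -` {(outdeg s w, u ! length w)}"
    using True by (auto simp: spine_mark_def)
  ultimately show ?thesis using True by simp
next
  case False
  have "pmf p (outdeg s w) =
      measure (measure_pmf (pair_pmf p (special_pmf p))) (fst -` {outdeg s w})"
    by (subst map_fst_pair_pmf[symmetric, of _ "special_pmf p"]) (rule pmf_map)
  moreover have "spine_mark s u w = fst -` {outdeg s w}"
    using False by (auto simp: spine_mark_def)
  ultimately show ?thesis using False by simp
qed

text \<open>Each of the \<open>b\<close> proper prefixes of \<open>u\<close> is special and contributes a factor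
  \<open>(k p\<^sub>k / \<mu>) (1 / k) = p\<^sub>k / \<mu>\<close>, and each normal node a factor \<open>p\<^sub>k\<close>, where \<open>k\<close> is its offspring number.\<close>

lemma measure_spine:
  assumes p: "integrable (measure_pmf p) real" "0 < offspring_mean p"
    and u: "u \<in> nodes s" "length u = b"
  shows "measure (marks_law p) {\<omega>. \<forall>w\<in>{w \<in> nodes s. length w < b}. \<omega> w \<in> spine_mark s u w} =
      tree_weight p b s / offspring_mean p ^ b"
    and "{\<omega>. \<forall>w\<in>{w \<in> nodes s. length w < b}. \<omega> w \<in> spine_mark s u w} \<in> sets (marks_law p)"
proof -
  let ?J = "{w \<in> nodes s. length w < b}" and ?m = "offspring_mean p"
  let ?Q = "measure_pmf (pair_pmf p (special_pmf p))"
  let ?S = "{\<omega>. \<forall>w\<in>?J. \<omega> w \<in> spine_mark s u w}"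
  interpret product_prob_space "\<lambda>_. ?Q" "UNIV :: nat list set"
    by (intro product_prob_spaceI measure_pmf.prob_space_axioms)
  have fin: "finite ?J" by (rule finite_words_below)
  have S: "?S = prod_emb UNIV (\<lambda>_. ?Q) ?J (Pi\<^sub>E ?J (spine_mark s u))"
    by (auto simp: prod_emb_def space_PiM Pi_iff)
  show "?S \<in> sets (marks_law p)"
    unfolding S marks_law_def using fin by (intro sets_PiM_I) auto
  have "measure (marks_law p) ?S = (\<Prod>w\<in>?J. measure ?Q (spine_mark s u w))"
    unfolding S marks_law_def using fin by (intro measure_PiM_emb) auto
  also have "\<dots> = (\<Prod>w\<in>?J. pmf p (outdeg s w) * (if w = take (length w) u then 1 / ?m else 1))"
    using u by (intro prod.cong refl measure_spine_mark p) auto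
  also have "\<dots> = tree_weight p b s * (\<Prod>w\<in>?J. if w = take (length w) u then 1 / ?m else 1)"
    by (simp add: prod.distrib tree_weight_def)
  also have "(\<Prod>w\<in>?J. if w = take (length w) u then 1 / ?m else 1) =
      (\<Prod>w\<in>{w \<in> ?J. w = take (length w) u}. 1 / ?m)"
    using fin by (simp only: prod.inter_filter)
  also have "{w \<in> ?J. w = take (length w) u} = (\<lambda>i. take i u) ` {..<b}"
  proof (intro equalityI subsetI)
    fix w assume "w \<in> (\<lambda>i. take i u) ` {..<b}"
    then obtain i where "i < b" "w = take i u" by blast
    then show "w \<in> {w \<in> ?J. w = take (length w) u}"
      using u nodes_prefix[of "take i u" "drop i u" s] by simp
  qed auto
  also have "(\<Prod>w\<in>(\<lambda>i. take i u) ` {..<b}. 1 / ?m) = 1 / ?m ^ b"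
  proof -
    have "inj_on (\<lambda>i. take i u) {..<b}"
      using u(2) by (intro inj_onI) (metis length_take lessThan_iff min.absorb4 min.strict_order_iff)
    then show ?thesis by (simp add: card_image power_one_over)
  qed
  finally show "measure (marks_law p) ?S = tree_weight p b s / ?m ^ b" by simp
qed

text \<open>Up to height \<open>b\<close>, the immortal tree is the Galton--Watson tree biased by the size of
  generation \<open>b\<close>. Each choice of the special node at height \<open>b\<close> contributes the same probability.
  The upper bound suffices for what follows.\<close>

lemma immortal_law_cylinder_le:
  assumes p: "integrable (measure_pmf p) real" "0 < offspring_mean p"
  shows "measure (immortal_law p) {t. trunc b t = s} \<le>
    real (card {u \<in> nodes s. length u = b}) * (tree_weight p b s / offspring_mean p ^ b)"
proof -
  let ?U = "{u \<in> nodes s. length u = b}" and ?J = "{w \<in> nodes s. length w < b}"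
  define S where "S u = {\<omega>. \<forall>w\<in>?J. \<omega> w \<in> spine_mark s u w}" for u
  interpret marks: prob_space "marks_law p" by (rule prob_space_marks_law)
  have S: "S u \<in> sets (marks_law p)"
    and measure_S: "measure (marks_law p) (S u) = tree_weight p b s / offspring_mean p ^ b"
    if "u \<in> ?U" for u
    using measure_spine[OF p, of u s b] that by (auto simp: S_def)
  have US: "(\<Union>u\<in>?U. S u) \<in> sets (marks_law p)"
    using S finite_words_of_length by (intro sets.finite_UN) auto
  have "AE \<omega> in marks_law p. 1 \<le> snd (snd (\<omega> w)) \<and> snd (snd (\<omega> w)) \<le> fst (snd (\<omega> w))" for w
    unfolding marks_law_def
  proof (rule AE_PiM_component)
    show "AE x in measure_pmf (pair_pmf p (special_pmf p)). 1 \<le> snd (snd x) \<and> snd (snd x) \<le> fst (snd x)"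
      using set_special_pmf[OF p] by (auto simp: AE_measure_pmf_iff)
  qed (auto intro: measure_pmf.prob_space_axioms)
  then have "AE \<omega> in marks_law p. \<forall>w. 1 \<le> snd (snd (\<omega> w)) \<and> snd (snd (\<omega> w)) \<le> fst (snd (\<omega> w))"
    by (simp add: AE_all_countable)
  then have sub: "AE \<omega> in marks_law p. \<omega> \<in> {\<omega>. trunc b (immortal_tree \<omega>) = s} \<longrightarrow> \<omega> \<in> (\<Union>u\<in>?U. S u)"
  proof eventually_elim
    case (elim \<omega>)
    show ?case
    proof
      assume "\<omega> \<in> {\<omega>. trunc b (immortal_tree \<omega>) = s}"
      then have eq: "trunc b (immortal_tree \<omega>) = s" by simp
      obtain u where u: "u \<in> nodes (immortal_tree \<omega>)" "length u = b" "is_special \<omega> u"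
        using special_node_at_height[of \<omega> b] elim by blast
      have "\<omega> w \<in> spine_mark s u w" if "w \<in> ?J" for w
      proof -
        have "w \<in> nodes (immortal_tree \<omega>)" "length w < b"
          using that eq by (auto simp: nodes_trunc)
        then have deg: "outdeg s w = offspring \<omega> w"
          using eq outdeg_trunc outdeg_immortal_tree by metis
        show ?thesis
        proof (cases "w = take (length w) u")
          case True
          then have "is_special \<omega> w" using is_special_take[OF u(3)] by metis
          moreover have "u ! length w = snd (snd (\<omega> w))"
            using u(2,3) True \<open>length w < b\<close> unfolding is_special_def by metis
          ultimately show ?thesis using True deg
            by (simp add: spine_mark_def offspring_def prod_eq_iff)
        next
          case False
          then have "\<not> is_special \<omega> w"
            using is_special_unique[OF is_special_take[OF u(3), of "length w"], of w]
              u(2) \<open>length w < b\<close> by auto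
          then show ?thesis using False deg by (simp add: spine_mark_def offspring_def)
        qed
      qed
      moreover have "u \<in> ?U" using u eq by (auto simp: nodes_trunc)
      ultimately show "\<omega> \<in> (\<Union>u\<in>?U. S u)" by (auto simp: S_def)
    qed
  qed
  have "measure (immortal_law p) {t. trunc b t = s} =
      measure (marks_law p) {\<omega>. trunc b (immortal_tree \<omega>) = s}"
    unfolding immortal_law_def
    by (subst measure_distr[OF measurable_immortal_tree]) (auto simp: sets_cylinder vimage_def)
  also have "\<dots> \<le> measure (marks_law p) (\<Union>u\<in>?U. S u)"
    by (rule marks.finite_measure_mono_AE[OF sub US])
  also have "\<dots> \<le> (\<Sum>u\<in>?U. measure (marks_law p) (S u))"
    using S finite_words_of_length by (intro marks.finite_measure_subadditive_finite) auto
  also have "\<dots> = real (card ?U) * (tree_weight p b s / offspring_mean p ^ b)"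
    using measure_S by simp
  finally show ?thesis .
qed

section \<open>Conditioning on the functional\<close>

lemma eventually_along_positive:
  "eventually P (along_positive v) \<longleftrightarrow> (\<exists>N. \<forall>n\<ge>N. v n > 0 \<longrightarrow> P n)"
  by (simp add: along_positive_def eventually_inf_principal eventually_sequentially)

text \<open>A property along the support of \<open>v\<close> may be used at \<open>n - m\<close> once \<open>n - m\<close> is known to lie in
  the support.\<close>

lemma eventually_along_positive_shift:
  assumes "eventually P (along_positive v)"
    and "eventually (\<lambda>n. v (n - m) > 0) (along_positive v)"
  shows "eventually (\<lambda>n. P (n - m)) (along_positive v)"
proof -
  obtain N where N: "\<And>n. N \<le> n \<Longrightarrow> v n > 0 \<Longrightarrow> P n"
    using assms(1) unfolding eventually_along_positive by blast
  obtain N' where N': "\<And>n. N' \<le> n \<Longrightarrow> v n > 0 \<Longrightarrow> v (n - m) > 0"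
    using assms(2) unfolding eventually_along_positive by blast
  show ?thesis
    unfolding eventually_along_positive by (intro exI[of _ "max N' (N + m)"]) (use N N' in auto)
qed

lemma sets_forest_event:
  assumes "\<tau> \<in> borel_measurable M"
  shows "forest_event A M (\<lambda>\<omega>. [\<tau> \<omega>]) P \<in> sets M"
proof -
  have "forest_event A M (\<lambda>\<omega>. [\<tau> \<omega>]) P = (\<Union>t\<in>{t. finite_tree t} \<inter> {t. P (A [t])}. \<tau> -` {t} \<inter> space M)"
    by (auto simp: forest_event_def)
  also have "\<dots> \<in> sets M"
    by (intro sets.countable_UN'' countable_Int1 countable_finite_trees measurable_sets[OF assms]) auto
  finally show ?thesis .
qed

text \<open>By additivity, a forest with the value \<open>n - B s\<close>, placed on the nodes of \<open>s\<close> at height \<open>b\<close>,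
  gives a tree with the value \<open>n\<close>, provided that \<open>n\<close> is large.\<close>

lemma joint_prob_ge:
  assumes gw: "galton_watson p M \<tau>" and M: "prob_space M"
    and gwT: "\<And>i. galton_watson p M (T i)" and indep: "prob_space.indep_vars M (\<lambda>_. borel) T UNIV"
    and add: "additive_for_large A B"
    and b: "1 \<le> b" and s: "height s \<le> enat b"
    and k: "k = card {u \<in> nodes s. length u = b}" "1 \<le> k"
  shows "\<exists>n\<^sub>0. \<forall>n\<ge>n\<^sub>0. tree_weight p b s * forest_point_prob A M T k (n - B s) \<le>
    measure M (forest_event A M (\<lambda>\<omega>. [\<tau> \<omega>]) (\<lambda>a. a = n) \<inter> {\<omega> \<in> space M. trunc b (\<tau> \<omega>) = s})"
proof -
  interpret prob_space M by fact
  have meas: "\<tau> \<in> borel_measurable M" using gw by (simp add: galton_watson_def)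
  obtain n1 where n1: "\<And>t. finite_tree t \<Longrightarrow> trunc b t = s \<Longrightarrow> n1 \<le> A (forest_above b t) \<Longrightarrow>
      A [t] = A (forest_above b t) + B (trunc b t)"
    using add b s unfolding additive_for_large_def by meson
  show ?thesis
  proof (intro exI[of _ "n1 + B s"] allI impI)
    fix n assume n: "n1 + B s \<le> n"
    define L where "L = {ts. length ts = k \<and> (\<forall>t\<in>set ts. finite_tree t) \<and> A ts = n - B s}"
    have L: "\<And>ts. ts \<in> L \<Longrightarrow> length ts = k \<and> (\<forall>t\<in>set ts. finite_tree t)" by (simp add: L_def)
    have cyl: "{\<omega> \<in> space M. trunc b (\<tau> \<omega>) = s} \<in> sets M"
      using measurable_sets[OF meas sets_cylinder[of b s]]
      by (simp add: vimage_def Int_def conj_commute)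
    have "forest_event A M (\<lambda>\<omega>. map (\<lambda>i. T i \<omega>) [1..<Suc k]) (\<lambda>a. a = n - B s) =
        {\<omega> \<in> space M. map (\<lambda>i. T i \<omega>) [1..<Suc k] \<in> L}"
      by (auto simp: forest_event_def L_def simp del: upt_Suc)
    then have "tree_weight p b s * forest_point_prob A M T k (n - B s) =
        prob {\<omega> \<in> space M. trunc b (\<tau> \<omega>) = s \<and> forest_above b (\<tau> \<omega>) \<in> L}"
      using galton_watson_forest_above(1)[OF gw M gwT indep s k L]
      by (simp only: forest_point_prob_def)
    also have "\<dots> \<le> prob (forest_event A M (\<lambda>\<omega>. [\<tau> \<omega>]) (\<lambda>a. a = n) \<inter>
        {\<omega> \<in> space M. trunc b (\<tau> \<omega>) = s})"
    proof (rule finite_measure_mono)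
      show "{\<omega> \<in> space M. trunc b (\<tau> \<omega>) = s \<and> forest_above b (\<tau> \<omega>) \<in> L} \<subseteq>
          forest_event A M (\<lambda>\<omega>. [\<tau> \<omega>]) (\<lambda>a. a = n) \<inter> {\<omega> \<in> space M. trunc b (\<tau> \<omega>) = s}"
      proof safe
        fix \<omega> assume \<omega>: "\<omega> \<in> space M" "forest_above b (\<tau> \<omega>) \<in> L" and eq: "s = trunc b (\<tau> \<omega>)"
        have fin: "finite_tree (\<tau> \<omega>)" using \<omega> finite_tree_forest_above by (auto simp: L_def)
        have "A (forest_above b (\<tau> \<omega>)) = n - B s" using \<omega> by (simp add: L_def)
        then have "A [\<tau> \<omega>] = n" using n1[OF fin eq[symmetric]] n eq by simp
        then show "\<omega> \<in> forest_event A M (\<lambda>\<omega>. [\<tau> \<omega>]) (\<lambda>a. a = n)"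
          using fin \<omega> by (simp add: forest_event_def)
      qed
    qed (intro sets.Int cyl sets_forest_event meas)
    finally show "tree_weight p b s * forest_point_prob A M T k (n - B s) \<le>
      prob (forest_event A M (\<lambda>\<omega>. [\<tau> \<omega>]) (\<lambda>a. a = n) \<inter> {\<omega> \<in> space M. trunc b (\<tau> \<omega>) = s})" .
  qed
qed

lemma conditional_law_if_positive:
  assumes M: "prob_space M" and meas: "\<tau> \<in> borel_measurable M" and pos: "point_prob A M \<tau> n > 0"
  shows "prob_space (conditional_law A M \<tau> n)"
    and "sets (conditional_law A M \<tau> n) = sets borel"
    and "measure (conditional_law A M \<tau> n) {t. trunc b t = s} =
      measure M (forest_event A M (\<lambda>\<omega>. [\<tau> \<omega>]) (\<lambda>a. a = n) \<inter> {\<omega> \<in> space M. trunc b (\<tau> \<omega>) = s}) /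
      point_prob A M \<tau> n"
proof -
  interpret prob_space M by fact
  let ?E = "forest_event A M (\<lambda>\<omega>. [\<tau> \<omega>]) (\<lambda>a. a = n)"
  have E: "emeasure M ?E \<noteq> 0" "emeasure M ?E \<noteq> \<infinity>"
    using pos by (auto simp: point_prob_def emeasure_eq_measure)
  have meas': "\<tau> \<in> borel_measurable (uniform_measure M ?E)"
    using meas by (simp add: measurable_def)
  show "prob_space (conditional_law A M \<tau> n)"
    unfolding conditional_law_def
    by (intro prob_space.prob_space_distr prob_space_uniform_measure E meas')
  show "sets (conditional_law A M \<tau> n) = sets borel" by (simp add: conditional_law_def)
  have cyl: "\<tau> -` {t. trunc b t = s} \<inter> space M = {\<omega> \<in> space M. trunc b (\<tau> \<omega>) = s}" by auto
  moreover have "\<tau> -` {t. trunc b t = s} \<inter> space M \<in> sets M"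
    by (rule measurable_sets[OF meas sets_cylinder])
  ultimately show "measure (conditional_law A M \<tau> n) {t. trunc b t = s} =
      measure M (?E \<inter> {\<omega> \<in> space M. trunc b (\<tau> \<omega>) = s}) / point_prob A M \<tau> n"
    unfolding conditional_law_def point_prob_def
    by (subst measure_distr[OF meas' sets_cylinder]) (simp add: E)
qed

lemma tail_prob_pos_imp_point_prob_pos:
  assumes M: "prob_space M" and meas: "\<tau> \<in> borel_measurable M" and pos: "tail_prob A M \<tau> n > 0"
  shows "\<exists>m>n. point_prob A M \<tau> m > 0"
proof (rule ccontr)
  assume *: "\<not> (\<exists>m>n. point_prob A M \<tau> m > 0)"
  interpret prob_space M by fact
  let ?E = "\<lambda>m. forest_event A M (\<lambda>\<omega>. [\<tau> \<omega>]) (\<lambda>a. a = m)"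
  have "?E m \<in> null_sets M" if "m \<in> {n<..}" for m
  proof -
    have "\<not> 0 < measure M (?E m)" using * that by (simp add: point_prob_def)
    then have "measure M (?E m) = 0" using measure_nonneg[of M "?E m"] by linarith
    then show ?thesis
      using sets_forest_event[OF meas] by (auto simp: null_sets_def emeasure_eq_measure)
  qed
  then have "(\<Union>m\<in>{n<..}. ?E m) \<in> null_sets M" by (intro null_sets_UN') auto
  moreover have "forest_event A M (\<lambda>\<omega>. [\<tau> \<omega>]) (\<lambda>a. a > n) = (\<Union>m\<in>{n<..}. ?E m)"
    by (auto simp: forest_event_def)
  ultimately have "tail_prob A M \<tau> n = 0"
    by (simp add: tail_prob_def measure_eq_0_null_sets)
  with pos show False by simp
qed

section \<open>Ratio limits along the support\<close>

lemma eventually_of_Liminf_ratio: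
  assumes "ereal c \<le> Liminf (along_positive v) (\<lambda>n. ereal (w n) / ereal (v n))" and "d < c"
  shows "eventually (\<lambda>n. d * v n < w n) (along_positive v)"
proof -
  have "eventually (\<lambda>n. ereal d < ereal (w n) / ereal (v n)) (along_positive v)"
    using assms by (simp add: le_Liminf_iff)
  then show ?thesis
    unfolding eventually_along_positive by (auto simp: pos_less_divide_eq)
qed

lemma eventually_of_Limsup_ratio_shift:
  assumes "Limsup (along_positive v) (\<lambda>n. ereal (v n) / ereal (v (n - m))) \<le> ereal c"
    and "c < r" and nonneg: "\<And>n. 0 \<le> v n"
  shows "eventually (\<lambda>n. 0 < v (n - m) \<and> v n \<le> r * v (n - m)) (along_positive v)"
proof -
  have "eventually (\<lambda>n. ereal (v n) / ereal (v (n - m)) < ereal r) (along_positive v)"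
    using assms by (simp add: Limsup_le_iff)
  moreover have "0 < v (n - m) \<and> v n \<le> r * v (n - m)"
    if "ereal (v n) / ereal (v (n - m)) < ereal r" "v n > 0" for n
  proof -
    \<comment> \<open>A vanishing denominator would make the quotient infinite.\<close>
    have "v (n - m) \<noteq> 0" using that by auto
    with nonneg[of "n - m"] have "0 < v (n - m)" by simp
    with that show ?thesis by (simp add: pos_divide_less_eq less_imp_le)
  qed
  ultimately show ?thesis unfolding eventually_along_positive by blast
qed

lemma eventually_of_Limsup_ratio_Suc:
  assumes limsup: "Limsup (along_positive v) (\<lambda>n. ereal (v (n + 1)) / ereal (v n)) \<le> ereal \<mu>"
    and pos: "\<And>n. N \<le> n \<Longrightarrow> v n > 0" and \<mu>: "0 < \<mu>" "\<mu> ^ b < r"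
  shows "eventually (\<lambda>n. 0 < v (n - b) \<and> v n \<le> r * v (n - b)) (along_positive v)"
proof -
  have "((\<lambda>x. x ^ b) \<longlongrightarrow> \<mu> ^ b) (at_right \<mu>)" by (intro tendsto_intros)
  then have "eventually (\<lambda>x. x ^ b < r) (at_right \<mu>)" using \<mu>(2) by (rule order_tendstoD)
  then have "eventually (\<lambda>x. \<mu> < x \<and> x ^ b < r) (at_right \<mu>)"
    by (intro eventually_conj eventually_at_right_less)
  then obtain x where x: "\<mu> < x" "x ^ b < r"
    using eventually_happens'[of "at_right \<mu>"] trivial_limit_at_right_real by blast
  have "eventually (\<lambda>n. ereal (v (n + 1)) / ereal (v n) < ereal x) (along_positive v)"
    using limsup x(1) by (simp add: Limsup_le_iff)
  then obtain N' where N': "\<And>n. N' \<le> n \<Longrightarrow> v n > 0 \<Longrightarrow> ereal (v (n + 1)) / ereal (v n) < ereal x"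
    unfolding eventually_along_positive by blast
  define K where "K = max N N'"
  have step: "v (Suc n) \<le> x * v n" if "K \<le> n" for n
  proof -
    have "v n > 0" using pos that by (simp add: K_def)
    with N'[of n] that show ?thesis by (simp add: K_def pos_divide_less_eq less_imp_le)
  qed
  have iterate: "v (n + j) \<le> x ^ j * v n" if "K \<le> n" for n j
  proof (induction j)
    case (Suc j)
    have "v (n + Suc j) \<le> x * v (n + j)" using step[of "n + j"] that by simp
    also have "\<dots> \<le> x * (x ^ j * v n)" using Suc x(1) \<mu>(1) by (intro mult_left_mono) auto
    finally show ?case by (simp add: mult.assoc)
  qed simp
  have "0 < v (n - b) \<and> v n \<le> r * v (n - b)" if "K + b \<le> n" for n
  proof -
    have v: "0 < v (n - b)" using pos that by (simp add: K_def)
    have "v n \<le> x ^ b * v (n - b)" using iterate[of "n - b" b] that by simp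
    also have "\<dots> \<le> r * v (n - b)" using x(2) v by (intro mult_right_mono) auto
    finally show ?thesis using v by simp
  qed
  then show ?thesis unfolding eventually_along_positive by blast
qed

lemma offspring_mean_pos_imp:
  assumes "0 < offspring_mean p"
  obtains k where "1 \<le> k" "0 < pmf p k"
proof -
  have "\<exists>k\<ge>1. pmf p k \<noteq> 0"
  proof (rule ccontr)
    assume "\<not> (\<exists>k\<ge>1. pmf p k \<noteq> 0)"
    then have "AE x in measure_pmf p. real x = 0"
      by (auto simp: AE_measure_pmf_iff set_pmf_eq Suc_le_eq)
    then have "offspring_mean p = 0" unfolding offspring_mean_def by (rule integral_eq_zero_AE)
    with assms show False by simp
  qed
  then show thesis using that by (auto simp: pmf_pos)
qed

text \<open>If \<open>B\<close> is the height, then joining \<open>k \<ge> 1\<close> trees by a root, where \<open>p\<^sub>k > 0\<close>, increases a large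
  value of the functional by one. Hence \<open>v\<^sub>n > 0\<close> implies \<open>v\<^sub>n\<^sub>+\<^sub>1 > 0\<close> for large \<open>n\<close>, and the support
  of \<open>v\<close>, which is unbounded, contains all large \<open>n\<close>. This rules out that \<open>v\<^sub>n\<^sub>-\<^sub>b\<close> vanishes
  along the support, which the condition on \<open>v\<^sub>n\<^sub>+\<^sub>1 / v\<^sub>n\<close> alone does not.\<close>

lemma eventually_point_prob_pos:
  assumes gw: "galton_watson p M \<tau>" and M: "prob_space M"
    and gwT: "\<And>i. galton_watson p M (T i)" and indep: "prob_space.indep_vars M (\<lambda>_. borel) T UNIV"
    and add: "additive_for_large A B" and mean: "0 < offspring_mean p"
    and pos: "\<And>n. tail_prob A M \<tau> n > 0"
    and B: "\<And>t. finite_tree t \<Longrightarrow> enat (B t) = height t"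
    and forests: "\<And>k. 1 \<le> k \<Longrightarrow> ereal (real k) \<le> Liminf (along_positive (point_prob A M \<tau>))
      (\<lambda>n. ereal (forest_point_prob A M T k n) / ereal (point_prob A M \<tau> n))"
  shows "\<exists>N. \<forall>n\<ge>N. point_prob A M \<tau> n > 0"
proof -
  interpret prob_space M by fact
  let ?v = "point_prob A M \<tau>"
  have meas: "\<tau> \<in> borel_measurable M" using gw by (simp add: galton_watson_def)
  obtain k where k: "1 \<le> k" "0 < pmf p k" by (rule offspring_mean_pos_imp[OF mean])
  have "\<P>(\<omega> in M. outdeg (\<tau> \<omega>) [] = k \<and> (\<forall>i\<in>{1..k}. subtree (\<tau> \<omega>) [i] \<in> UNIV)) =
      pmf p k * (\<Prod>i\<in>{1..k}. \<P>(\<omega> in M. \<tau> \<omega> \<in> UNIV))"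
    using gw[unfolded galton_watson_def, THEN conjunct2, rule_format, of "\<lambda>_. UNIV" k] by simp
  then have "\<P>(\<omega> in M. outdeg (\<tau> \<omega>) [] = k) = pmf p k" by (simp add: prob_space)
  then have "{\<omega> \<in> space M. outdeg (\<tau> \<omega>) [] = k} \<noteq> {}" using k by force
  then obtain t where t: "outdeg t [] = k" by blast
  define s where "s = trunc 1 t"
  have deg: "outdeg s [] = k" using t by (simp add: s_def outdeg_trunc)
  have s: "height s \<le> enat 1" unfolding s_def by (rule height_trunc)
  have "{u \<in> nodes s. length u = 1} = (\<lambda>i. [i]) ` {1..k}"
  proof (rule set_eqI)
    fix u show "u \<in> {u \<in> nodes s. length u = 1} \<longleftrightarrow> u \<in> (\<lambda>i. [i]) ` {1..k}"
      by (cases u) (auto simp: Cons_in_nodes_iff deg)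
  qed
  then have card: "k = card {u \<in> nodes s. length u = 1}" by (simp add: card_image inj_on_def)
  have "tree_weight p (Suc 0) s = pmf p k" unfolding tree_weight_Suc by (simp add: deg tree_weight_def)
  moreover have "B s = 1"
  proof -
    have "[1] \<in> nodes s" using k(1) deg by (simp add: Cons_in_nodes_iff)
    then have "\<not> height s \<le> enat 0" by (auto simp: height_le_iff)
    then show ?thesis using B[of s] s by (simp add: s_def finite_tree_trunc flip: B)
  qed
  ultimately obtain n0 where n0: "\<And>n. n0 \<le> n \<Longrightarrow> pmf p k * forest_point_prob A M T k (n - 1) \<le>
      measure M (forest_event A M (\<lambda>\<omega>. [\<tau> \<omega>]) (\<lambda>a. a = n) \<inter> {\<omega> \<in> space M. trunc 1 (\<tau> \<omega>) = s})"
    using joint_prob_ge[OF gw M gwT indep add _ s card k(1)] by auto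
  have "eventually (\<lambda>n. 0 * ?v n < forest_point_prob A M T k n) (along_positive ?v)"
    by (rule eventually_of_Liminf_ratio[OF forests[OF k(1)]]) (use k in simp)
  then obtain N where N: "\<And>n. N \<le> n \<Longrightarrow> ?v n > 0 \<Longrightarrow> 0 < forest_point_prob A M T k n"
    unfolding eventually_along_positive by auto
  have step: "?v (Suc n) > 0" if "max N n0 \<le> n" "?v n > 0" for n
  proof -
    have "0 < pmf p k * forest_point_prob A M T k (Suc n - 1)" using N that k by simp
    also have "\<dots> \<le> measure M (forest_event A M (\<lambda>\<omega>. [\<tau> \<omega>]) (\<lambda>a. a = Suc n) \<inter>
        {\<omega> \<in> space M. trunc 1 (\<tau> \<omega>) = s})"
      using that by (intro n0) simp
    also have "\<dots> \<le> ?v (Suc n)"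
      unfolding point_prob_def by (intro finite_measure_mono sets_forest_event meas) auto
    finally show ?thesis .
  qed
  obtain m where m: "max N n0 < m" "?v m > 0"
    using tail_prob_pos_imp_point_prob_pos[OF M meas pos] by blast
  have "?v n > 0" if "m \<le> n" for n
    using that
  proof (induction rule: dec_induct)
    case base
    show ?case by (rule m)
  next
    case (step n)
    then show ?case using \<open>\<And>n. max N n0 \<le> n \<Longrightarrow> ?v n > 0 \<Longrightarrow> ?v (Suc n) > 0\<close> m(1) by simp
  qed
  then show ?thesis by blast
qed

text \<open>The decisive estimate: asymptotically, the conditional law gives the cylinder of \<open>s\<close> at least
  the size-biased probability. With \<open>m\<close> for the power \<open>\<mu>\<^sup>b\<close>, the two hypotheses bound the factors of
  \<open>v\<^sub>n\<^sub>-\<^sub>B\<^sub>s(k) / v\<^sub>n = (v\<^sub>n\<^sub>-\<^sub>B\<^sub>s(k) / v\<^sub>n\<^sub>-\<^sub>B\<^sub>s) (v\<^sub>n\<^sub>-\<^sub>B\<^sub>s / v\<^sub>n)\<close> from below by \<open>k - e\<close> and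
  \<open>1 / (m + e)\<close>.\<close>

lemma eventually_conditional_cylinder:
  assumes gw: "galton_watson p M \<tau>" and M: "prob_space M"
    and gwT: "\<And>i. galton_watson p M (T i)" and indep: "prob_space.indep_vars M (\<lambda>_. borel) T UNIV"
    and add: "additive_for_large A B" and m: "0 < m"
    and b: "1 \<le> b" and s: "height s \<le> enat b"
    and k: "k = card {u \<in> nodes s. length u = b}" "1 \<le> k"
    and forests: "ereal (real k) \<le> Liminf (along_positive (point_prob A M \<tau>))
      (\<lambda>n. ereal (forest_point_prob A M T k n) / ereal (point_prob A M \<tau> n))"
    and ratio: "\<And>r. m < r \<Longrightarrow> eventually (\<lambda>n. 0 < point_prob A M \<tau> (n - B s) \<and>
      point_prob A M \<tau> n \<le> r * point_prob A M \<tau> (n - B s)) (along_positive (point_prob A M \<tau>))"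
    and x: "x < real k * (tree_weight p b s / m)"
  shows "eventually (\<lambda>n. x < measure (conditional_law A M \<tau> n) {t. trunc b t = s})
    (along_positive (point_prob A M \<tau>))"
proof -
  interpret prob_space M by fact
  let ?v = "point_prob A M \<tau>" and ?c = "tree_weight p b s"
  let ?J = "\<lambda>n. measure M (forest_event A M (\<lambda>\<omega>. [\<tau> \<omega>]) (\<lambda>a. a = n) \<inter>
    {\<omega> \<in> space M. trunc b (\<tau> \<omega>) = s})"
  have meas: "\<tau> \<in> borel_measurable M" using gw by (simp add: galton_watson_def)
  have "((\<lambda>e. ?c * (real k - e) / (m + e)) \<longlongrightarrow> ?c * (real k - 0) / (m + 0)) (at_right 0)"
    using m by (intro tendsto_intros) auto
  moreover have "x < ?c * (real k - 0) / (m + 0)" using x by (simp add: mult.commute)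
  ultimately have "eventually (\<lambda>e. x < ?c * (real k - e) / (m + e)) (at_right 0)"
    by (rule order_tendstoD)
  moreover have "eventually (\<lambda>e::real. 0 < e \<and> e < 1) (at_right 0)"
    by (intro eventually_conj eventually_at_right_less eventually_at_right_real[of 0 1, THEN eventually_mono]) auto
  ultimately have "eventually (\<lambda>e. x < ?c * (real k - e) / (m + e) \<and> 0 < e \<and> e < 1) (at_right 0)"
    by (rule eventually_conj)
  then obtain e where e: "x < ?c * (real k - e) / (m + e)" "0 < e" "e < 1"
    using eventually_happens'[of "at_right (0::real)"] trivial_limit_at_right_real by blast
  obtain n0 where n0: "\<And>n. n0 \<le> n \<Longrightarrow> ?c * forest_point_prob A M T k (n - B s) \<le> ?J n"
    using joint_prob_ge[OF gw M gwT indep add b s k] by blast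
  have r: "eventually (\<lambda>n. 0 < ?v (n - B s) \<and> ?v n \<le> (m + e) * ?v (n - B s)) (along_positive ?v)"
    using e by (intro ratio) simp
  have "eventually (\<lambda>n. (real k - e) * ?v n < forest_point_prob A M T k n) (along_positive ?v)"
    using e by (intro eventually_of_Liminf_ratio[OF forests]) simp
  then have "eventually (\<lambda>n. (real k - e) * ?v (n - B s) < forest_point_prob A M T k (n - B s))
      (along_positive ?v)"
    by (rule eventually_along_positive_shift) (use r in \<open>auto elim: eventually_mono\<close>)
  moreover have "eventually (\<lambda>n. n0 \<le> n \<and> ?v n > 0) (along_positive ?v)"
    unfolding eventually_along_positive by blast
  ultimately show ?thesis using r
  proof eventually_elim
    case (elim n)
    have "x * ?v n < ?c * (real k - e) / (m + e) * ?v n"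
      using e(1) elim by (intro mult_strict_right_mono) auto
    also have "\<dots> \<le> ?c * (real k - e) / (m + e) * ((m + e) * ?v (n - B s))"
      using e k(2) m elim by (intro mult_left_mono) (auto simp: tree_weight_nonneg)
    also have "\<dots> = ?c * ((real k - e) * ?v (n - B s))" using m e by simp
    also have "\<dots> \<le> ?c * forest_point_prob A M T k (n - B s)"
      using elim by (intro mult_left_mono) (auto simp: tree_weight_nonneg)
    also have "\<dots> \<le> ?J n" using elim by (intro n0) simp
    finally have "x < ?J n / ?v n" using elim by (simp add: pos_less_divide_eq)
    then show ?case using elim by (simp add: conditional_law_if_positive(3)[OF M meas])
  qed
qed

section \<open>The limit of the conditioned tree\<close>

theorem theorem2p3:
  fixes p :: "nat pmf" and \<mu> :: real
    and M :: "'a measure" and \<tau> :: "'a \<Rightarrow> tree" and T :: "nat \<Rightarrow> 'a \<Rightarrow> tree"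
    and A :: "tree list \<Rightarrow> nat" and B :: "tree \<Rightarrow> nat"
    and v :: "nat \<Rightarrow> real" and vf :: "nat \<Rightarrow> nat \<Rightarrow> real"
  assumes "integrable (measure_pmf p) real" and "offspring_mean p = \<mu>"
    and "0 < \<mu>" and "\<mu> \<le> 1" and "pmf p 1 \<noteq> 1"
    and "prob_space M"
    and "galton_watson p M \<tau>"
    and "prob_space.indep_vars M (\<lambda>_. borel) T UNIV" and "\<And>i. galton_watson p M (T i)"
    and "\<And>n. v n = point_prob A M \<tau> n"
    and "\<And>k n. vf k n = forest_point_prob A M T k n"
    and positive: "\<And>n. tail_prob A M \<tau> n > 0"
    and additive: "additive_for_large A B"
    and forests: "\<And>k. k \<ge> 1 \<Longrightarrow>
      Liminf (along_positive v) (\<lambda>n. ereal (vf k n) / ereal (v n)) \<ge> ereal (real k)"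
    and ratio: "(\<mu> = 1 \<and> (\<forall>t. finite_tree t \<longrightarrow>
          Limsup (along_positive v) (\<lambda>n. ereal (v n) / ereal (v (n - B t))) \<le> 1)) \<or>
      ((\<forall>t. finite_tree t \<longrightarrow> enat (B t) = height t) \<and>
          Limsup (along_positive v) (\<lambda>n. ereal (v (n + 1)) / ereal (v n)) \<le> ereal \<mu>)"
  shows "converges_in_law (conditional_law A M \<tau>) (immortal_law p) (along_positive v)"
proof -
  note p = assms(1) and mean = assms(2) and \<mu> = assms(3) and M = assms(6) and gw = assms(7)
    and indep = assms(8) and gwT = assms(9)
  interpret prob_space M by fact
  have meas: "\<tau> \<in> borel_measurable M" using gw by (simp add: galton_watson_def)
  have v: "v = point_prob A M \<tau>" and vf: "vf = forest_point_prob A M T"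
    using assms(10,11) by (auto simp: fun_eq_iff)
  have v_nonneg: "0 \<le> v n" for n by (simp add: v point_prob_def)
  have mean_pos: "0 < offspring_mean p" using mean \<mu> by simp
  show ?thesis
  proof (rule converges_in_law_if_cylinders)
    show "eventually (\<lambda>n. prob_space (conditional_law A M \<tau> n) \<and>
        sets (conditional_law A M \<tau> n) = sets borel) (along_positive v)"
      unfolding eventually_along_positive v using conditional_law_if_positive(1,2)[OF M meas] by blast
    show "prob_space (immortal_law p)" by (rule prob_space_immortal_law)
    show "sets (immortal_law p) = sets borel" by (simp add: immortal_law_def)
  next
    fix b s x
    assume b: "1 \<le> b" and x: "x < measure (immortal_law p) {t. trunc b t = s}"
    let ?k = "card {u \<in> nodes s. length u = b}"
    have x': "x < real ?k * (tree_weight p b s / \<mu> ^ b)"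
      using x immortal_law_cylinder_le[OF p mean_pos, of b s] mean by simp
    show "eventually (\<lambda>n. x < measure (conditional_law A M \<tau> n) {t. trunc b t = s}) (along_positive v)"
    proof (cases "1 \<le> ?k \<and> height s \<le> enat b")
      case False
      \<comment> \<open>Either \<open>s\<close> has no node at height \<open>b\<close>, whereas the immortal tree always has one,
        or the cylinder is empty.\<close>
      have "x < 0"
      proof (cases "height s \<le> enat b")
        case True
        then show ?thesis using False x' by (simp add: not_le)
      next
        case False
        then have "{t. trunc b t = s} = {}" using height_trunc by blast
        then show ?thesis using x by simp
      qed
      then show ?thesis by (intro always_eventually allI less_le_trans[OF _ measure_nonneg])
    next
      case True
      then have k: "1 \<le> ?k" and s: "height s \<le> enat b" by auto
      have fin: "finite_tree s" by (rule finite_tree_if_height_le[OF s])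
      have "eventually (\<lambda>n. 0 < v (n - B s) \<and> v n \<le> r * v (n - B s)) (along_positive v)"
        if r: "\<mu> ^ b < r" for r
        using ratio
      proof
        assume case_I: "\<mu> = 1 \<and> (\<forall>t. finite_tree t \<longrightarrow>
          Limsup (along_positive v) (\<lambda>n. ereal (v n) / ereal (v (n - B t))) \<le> 1)"
        then have "Limsup (along_positive v) (\<lambda>n. ereal (v n) / ereal (v (n - B s))) \<le> ereal 1"
          using fin by (simp add: one_ereal_def)
        then show ?thesis
          by (rule eventually_of_Limsup_ratio_shift) (use r case_I v_nonneg in auto)
      next
        assume case_II: "(\<forall>t. finite_tree t \<longrightarrow> enat (B t) = height t) \<and>
          Limsup (along_positive v) (\<lambda>n. ereal (v (n + 1)) / ereal (v n)) \<le> ereal \<mu>"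
        then obtain N where N: "\<And>n. N \<le> n \<Longrightarrow> v n > 0"
          using eventually_point_prob_pos[OF gw M gwT indep additive mean_pos positive]
            forests unfolding v vf by blast
        \<comment> \<open>As \<open>s\<close> has a node at height \<open>b\<close>, its height is exactly \<open>b\<close>.\<close>
        have "B s = b"
        proof -
          obtain u where "u \<in> nodes s" "length u = b"
            using k by (metis (mono_tags, lifting) Collect_empty_eq card.empty not_one_le_zero)
          then have "enat b \<le> height s"
            unfolding height_def by (metis SUP_upper)
          then show ?thesis using s case_II fin by (metis enat.inject order_antisym)
        qed
        then show ?thesis
          using eventually_of_Limsup_ratio_Suc[OF conjunct2[OF case_II] N \<mu> r] by simp
      qed
      then show ?thesis
        using eventually_conditional_cylinder[OF gw M gwT indep additive _ b s refl k _ _ x']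
          forests[OF k] \<mu> unfolding v vf by simp
    qed
  qed
qed

end
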